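(* Let $\rho\in[0,1)$, let $S\in\mathbb{R}^{N\times N}$ be symmetric positive definite, let $\{\sigma_k\}_{k\ge0}$ be a positive sequence with $\sigma_k\ge\sigma_{\min}>0$ for all $k\ge0$, and let $\{\tau_k\}_{k\ge0}$ be a positive sequence satisfying $$\tau_k\ge\tau_{\min}>0,\qquad \tau_{k+1}\le(1+\nu_k)\tau_k,\qquad \nu_k\ge0,\qquad \sum_{k=0}^\infty\nu_k<+\infty .$$ Suppose that $\ell$ admits a saddle point (i.e. $(\partial\ell)^{-1}(0,0)\ne\emptyset$) and that the following error bound condition holds: for any $r>0$ there exists $\kappa>0$ such that $$\mathrm{dist}\big((x,y),(\partial\ell)^{-1}(0,0)\big)\le\kappa\,\mathrm{dist}\big((0,0),\partial\ell(x,y)\big)$$ for all $(x,y)\in\mathbb{R}^N\times\mathbb{R}^M$ with $\mathrm{dist}((x,y),(\partial\ell)^{-1}(0,0))\le r$. Let $\{x^k\}$ and $\{y^k:=(\lambda^k,\mu^k)\}$ be (infinite) sequences generated by the rip$^2$ALM (defined in the context) with these parameters, let $r>0$ be such that $\mathrm{dist}((x^k,y^k),(\partial\ell)^{-1}(0,0))\le r$ for all $k\ge0$, and let $\kappa>0$ be a constant given by the error bound condition for this $r$. Suppose that $$\sqrt{\tau_{\min}\lambda_{\min}(S)}-2\sqrt{\rho}>0\quad\text{and}\quad\liminf_{k\to\infty}\sigma_k>c\cdot\frac{2\kappa\sqrt{\tau_{\max}\lambda_{\max}(S)}\,\big(\rho+\sqrt{\rho\,\overline{\tau}_{\max}}\big)}{\sqrt{\tau_{\min}\lambda_{\min}(S)}-2\sqrt{\rho}},$$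 where $c>1$ is an arbitrarily given constant, $\lambda_{\min}(S)$ and $\lambda_{\max}(S)$ are the smallest and largest eigenvalues of $S$, $\tau_{\max}:=\tau_0\prod_{k=0}^\infty(1+\nu_k)$, and $\overline{\tau}_{\max}:=\max\{1,\tau_{\max}\lambda_{\max}(S)\}$. Let $\Lambda_k:=\mathrm{Diag}(\tau_kS,I_M)$, $\overline{\tau}_k:=\max\{1,\tau_k\lambda_{\max}(S)\}$, and $$\gamma_k:=\left(1-\frac{2\kappa\sqrt{\tau_k\lambda_{\max}(S)}\,\big(\rho+\sqrt{\rho\overline{\tau}_k}\big)+2\sigma_k\sqrt{\rho}}{\sigma_k\sqrt{\tau_k\lambda_{\min}(S)}}\right)\frac{\sigma_k^2}{\kappa^2\big(\sqrt{\rho}+\sqrt{\overline{\tau}_k}\big)^2\overline{\tau}_k}.$$ Then the following hold. (i) For all sufficiently large $k$, $$\gamma_k\ge\Big(\frac{c-1}{c}\Big)\cdot\frac{\sqrt{\tau_{\min}\lambda_{\min}(S)}-2\sqrt{\rho}}{\sqrt{\tau_{\min}\lambda_{\min}(S)}}\cdot\frac{\sigma_k^2}{\kappa^2\big(\sqrt{\rho}+\sqrt{\overline{\tau}_{\max}}\big)^2\overline{\tau}_{\max}}>0$$ and $$\mathrm{dist}_{\Lambda_{k+1}}\big((x^{k+1},y^{k+1}),(\partial\ell)^{-1}(0,0)\big)\le\theta_k\,\mathrm{dist}_{\Lambda_k}\big((x^k,y^k),(\partial\ell)^{-1}(0,0)\big),$$ where $\theta_k:=\sqrt{\frac{1+\nu_k}{1+\gamma_k}}$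 satisfies $\limsup_{k\to\infty}\theta_k<1$. (ii) The whole sequence $\{x^k\}$ is convergent.
   Context: Problem. $f:\mathbb{R}^N\to\mathbb{R}\cup\{+\infty\}$ is a proper closed (lower semicontinuous) convex function, $A\in\mathbb{R}^{m_1\times N}$, $b\in\mathbb{R}^{m_1}$, and $g=(g_1,\dots,g_{m_2})$ with each $g_i:\mathbb{R}^N\to\mathbb{R}$ continuously differentiable and convex; $M:=m_1+m_2$. The problem is $\min_x f(x)$ subject to $Ax=b$, $g(x)\le0$ (componentwise). Lagrangian. For $y=(\lambda,\mu)\in\mathbb{R}^{m_1}\times\mathbb{R}^{m_2}$, $$\ell(x,y)=\begin{cases}f(x)+\langle\lambda,Ax-b\rangle+\langle\mu,g(x)\rangle,&\mu\ge0,\\-\infty,&\text{otherwise.}\end{cases}$$ Subdifferential of $\ell$: $(p,u)\in\partial\ell(x,y)$ iff $\ell(x',y)\ge\ell(x,y)+\langle p,x'-x\rangle$ for all $x'\in\mathbb{R}^N$ and $\ell(x,y')\le\ell(x,y)-\langle u,y'-y\rangle$ for all $y'\in\mathbb{R}^M$. For $\mu\ge0$ this gives $\partial\ell(x,(\lambda,\mu))=\{\partial f(x)+A^\top\lambda+\nabla g(x)^\top\mu\}\times(\{b-Ax\}\times\{-g(x)+\mathcal{N}_{\mathbb{R}^{m_2}_+}(\mu)\})$, where $\nabla g(x)$ is the Jacobian and $\mathcal{N}_{\mathbb{R}^{m_2}_+}$ the normal cone of $\mathbb{R}^{m_2}_+$. $(\partial\ell)^{-1}(p,u):=\{(x,y):(p,u)\in\partial\ell(x,y)\}$;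 a saddle point of $\ell$ is an element of $(\partial\ell)^{-1}(0,0)$. Norms and distances. $\|\cdot\|$ is Euclidean; for symmetric positive definite $H$, $\|x\|_H:=\sqrt{\langle x,Hx\rangle}$ and $\mathrm{dist}_H(x,\mathcal{C}):=\inf_{z\in\mathcal{C}}\|x-z\|_H$; $\mathrm{dist}$ without subscript is Euclidean (with the distance to the empty set being $+\infty$). $\mathrm{Diag}(\tau_kS,I_M)$ is the block-diagonal matrix with blocks $\tau_kS$ and the $M\times M$ identity. $\max$ and $\min$ of vectors are componentwise. Augmented Lagrangian: for $\sigma>0$ and $(x,\lambda,\mu)\in\mathbb{R}^N\times\mathbb{R}^{m_1}\times\mathbb{R}^{m_2}_+$, $$\mathcal{L}_\sigma(x,\lambda,\mu)=f(x)+\langle\lambda,Ax-b\rangle+\tfrac{\sigma}{2}\|Ax-b\|^2+\tfrac{1}{2\sigma}\|\max\{0,\mu+\sigma g(x)\}\|^2-\tfrac{1}{2\sigma}\|\mu\|^2 ,$$ with $\partial_x\mathcal{L}_\sigma$ its convex subdifferential in $x$. rip$^2$ALM. Inputs: $\rho\in[0,1)$, positive $\{\sigma_k\}$, $\{\tau_k\}$ bounded away from $0$, $S$ symmetric positive definite; arbitrary $w^0,x^0\in\mathbb{R}^N$, $\lambda^0\in\mathbb{R}^{m_1}$, $\mu^0\in\mathbb{R}^{m_2}_+$. For $k=0,1,2,\dots$: Step 1: find any $x^{k+1}$ and $\Delta^{k+1}$ in $\mathbb{R}^N$ (by approximately minimizing $\mathcal{L}_{\sigma_k}(x,\lambda^k,\mu^k)+\frac{\tau_k}{2\sigma_k}\|x-x^k\|_S^2$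 over $x$) such that $$\Delta^{k+1}\in\partial_x\mathcal{L}_{\sigma_k}(x^{k+1},\lambda^k,\mu^k)+\tau_k\sigma_k^{-1}S(x^{k+1}-x^k)$$ and $$2|\langle w^k-x^{k+1},\sigma_k\Delta^{k+1}\rangle|+\|\sigma_k\Delta^{k+1}\|^2\le\rho\Big(\|\sigma_k(Ax^{k+1}-b)\|^2+\|\min\{\mu^k,-\sigma_kg(x^{k+1})\}\|^2+\tau_k\|x^{k+1}-x^k\|_S^2\Big).$$ Step 2: set $\lambda^{k+1}=\lambda^k+\sigma_k(Ax^{k+1}-b)$, $\mu^{k+1}=\max\{0,\mu^k+\sigma_kg(x^{k+1})\}$, $w^{k+1}=w^k-\sigma_k\Delta^{k+1}$. *)

theory Defs
  imports "HOL-Analysis.Analysis"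
begin

section \<open>Extended-real-valued convex functions\<close>

definition proper_fun :: "('a \<Rightarrow> ereal) \<Rightarrow> bool" where
  "proper_fun f \<longleftrightarrow> (\<forall>x. f x \<noteq> -\<infinity>) \<and> (\<exists>x. f x \<noteq> \<infinity>)"

definition lsc_fun :: "('a::topological_space \<Rightarrow> ereal) \<Rightarrow> bool" where
  "lsc_fun f \<longleftrightarrow> (\<forall>x. f x \<le> Liminf (at x) f)"

definition convex_fun :: "('a::real_vector \<Rightarrow> ereal) \<Rightarrow> bool" where
  "convex_fun f \<longleftrightarrow> convex {(x, t::real). f x \<le> ereal t}"

definition subdiff :: "('a::real_inner \<Rightarrow> ereal) \<Rightarrow> 'a \<Rightarrow> 'a set" where
  "subdiff F x = {v. \<forall>x'. F x' \<ge> F x + ereal (v \<bullet> (x' - x))}"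

definition C1_fun :: "('a::real_inner \<Rightarrow> real) \<Rightarrow> bool" where
  "C1_fun h \<longleftrightarrow> (\<exists>G. continuous_on UNIV G \<and> (\<forall>x. (h has_derivative (\<lambda>d. G x \<bullet> d)) (at x)))"

section \<open>Matrices, weighted norms and distances\<close>

definition sym_pos_def :: "real^'n^'n \<Rightarrow> bool" where
  "sym_pos_def S \<longleftrightarrow> transpose S = S \<and> (\<forall>x. x \<noteq> 0 \<longrightarrow> 0 < x \<bullet> (S *v x))"

definition eigvals :: "real^'n^'n \<Rightarrow> real set" where
  "eigvals S = {e. \<exists>v. v \<noteq> 0 \<and> S *v v = e *\<^sub>R v}"

definition lambda_min :: "real^'n^'n \<Rightarrow> real" where
  "lambda_min S = Min (eigvals S)"

definition lambda_max :: "real^'n^'n \<Rightarrow> real" where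
  "lambda_max S = Max (eigvals S)"

text \<open>The weight is given as an operator, so that block-diagonal weights on
  product spaces are covered.\<close>

definition wnorm :: "('a::real_inner \<Rightarrow> 'a) \<Rightarrow> 'a \<Rightarrow> real" where
  "wnorm H x = sqrt (x \<bullet> H x)"

text \<open>Distances are extended reals, so the distance to the empty set is \<open>\<infinity>\<close>
  (unlike \<^const>\<open>infdist\<close> and \<^const>\<open>setdist\<close>, which return 0).\<close>

definition wdist :: "('a::real_inner \<Rightarrow> 'a) \<Rightarrow> 'a \<Rightarrow> 'a set \<Rightarrow> ereal" where
  "wdist H x C = (INF z\<in>C. ereal (wnorm H (x - z)))"

definition edist :: "'a::metric_space \<Rightarrow> 'a set \<Rightarrow> ereal" where
  "edist x C = (INF z\<in>C. ereal (dist x z))"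

text \<open>\<open>Diag(t S, I)\<close> on \<open>\<real>\<^sup>N \<times> \<real>\<^sup>M\<close>; the type of the second component determines \<open>M\<close>.\<close>

definition Diag_SI :: "real \<Rightarrow> real^'n^'n \<Rightarrow> (real^'n) \<times> 'y \<Rightarrow> (real^'n) \<times> 'y" where
  "Diag_SI t S = map_prod (\<lambda>x. (t *\<^sub>R S) *v x) id"

section \<open>Lagrangian and augmented Lagrangian\<close>

text \<open>The multiplier \<open>y = (\<lambda>, \<mu>)\<close> is a pair; the product type carries the Euclidean
  inner product and norm of \<open>\<real>\<^sup>M\<close>. The order \<open>0 \<le> \<mu>\<close> on vectors is componentwise.\<close>

definition lagr ::
  "(real^'n \<Rightarrow> ereal) \<Rightarrow> real^'n^'m1 \<Rightarrow> real^'m1 \<Rightarrow> (real^'n \<Rightarrow> real^'m2) \<Rightarrow>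
   real^'n \<Rightarrow> (real^'m1) \<times> (real^'m2) \<Rightarrow> ereal" where
  "lagr f A b g x y = (case y of (lam, mu) \<Rightarrow>
     if 0 \<le> mu then f x + ereal (lam \<bullet> (A *v x - b)) + ereal (mu \<bullet> g x) else -\<infinity>)"

text \<open>The subdifferential of a convex-concave function, with the sign convention
  \<open>p \<in> \<partial>\<^sub>x l(x,y)\<close> and \<open>u \<in> \<partial>\<^sub>y (-l)(x,y)\<close>.\<close>

definition saddle_subdiff ::
  "('a::real_inner \<Rightarrow> 'b::real_inner \<Rightarrow> ereal) \<Rightarrow> 'a \<times> 'b \<Rightarrow> ('a \<times> 'b) set" where
  "saddle_subdiff l = (\<lambda>(x, y). {(p, u).
     (\<forall>x'. l x' y \<ge> l x y + ereal (p \<bullet> (x' - x))) \<and>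
     (\<forall>y'. l x y' \<le> l x y - ereal (u \<bullet> (y' - y)))})"

definition saddle_subdiff_inv ::
  "('a::real_inner \<Rightarrow> 'b::real_inner \<Rightarrow> ereal) \<Rightarrow> 'a \<times> 'b \<Rightarrow> ('a \<times> 'b) set" where
  "saddle_subdiff_inv l pu = {xy. pu \<in> saddle_subdiff l xy}"

abbreviation saddle_points ::
  "('a::real_inner \<Rightarrow> 'b::real_inner \<Rightarrow> ereal) \<Rightarrow> ('a \<times> 'b) set" where
  "saddle_points l \<equiv> saddle_subdiff_inv l (0, 0)"

definition error_bound ::
  "('a::real_inner \<Rightarrow> 'b::real_inner \<Rightarrow> ereal) \<Rightarrow> real \<Rightarrow> real \<Rightarrow> bool" where
  "error_bound l r \<kappa> \<longleftrightarrow> (\<forall>xy. edist xy (saddle_points l) \<le> ereal r \<longrightarrow>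
     edist xy (saddle_points l) \<le> ereal \<kappa> * edist (0, 0) (saddle_subdiff l xy))"

definition aug_lagr ::
  "(real^'n \<Rightarrow> ereal) \<Rightarrow> real^'n^'m1 \<Rightarrow> real^'m1 \<Rightarrow> (real^'n \<Rightarrow> real^'m2) \<Rightarrow>
   real \<Rightarrow> real^'n \<Rightarrow> real^'m1 \<Rightarrow> real^'m2 \<Rightarrow> ereal" where
  "aug_lagr f A b g \<sigma> x lam mu = f x + ereal (
     lam \<bullet> (A *v x - b) + \<sigma> / 2 * (norm (A *v x - b))\<^sup>2
     + 1 / (2 * \<sigma>) * (norm (\<chi> i. max 0 (mu $ i + \<sigma> * g x $ i)))\<^sup>2
     - 1 / (2 * \<sigma>) * (norm mu)\<^sup>2)"

section \<open>The algorithm\<close>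

text \<open>\<open>rip2alm \<dots> w x \<Delta> lam mu\<close>: these sequences are a run of the relative-type inexact
  proximal augmented Lagrangian method; \<open>\<Delta> 0\<close> is irrelevant.\<close>

definition rip2alm ::
  "(real^'n \<Rightarrow> ereal) \<Rightarrow> real^'n^'m1 \<Rightarrow> real^'m1 \<Rightarrow> (real^'n \<Rightarrow> real^'m2) \<Rightarrow>
   real \<Rightarrow> (nat \<Rightarrow> real) \<Rightarrow> (nat \<Rightarrow> real) \<Rightarrow> real^'n^'n \<Rightarrow>
   (nat \<Rightarrow> real^'n) \<Rightarrow> (nat \<Rightarrow> real^'n) \<Rightarrow> (nat \<Rightarrow> real^'n) \<Rightarrow>
   (nat \<Rightarrow> real^'m1) \<Rightarrow> (nat \<Rightarrow> real^'m2) \<Rightarrow> bool" where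
  "rip2alm f A b g \<rho> \<sigma> \<tau> S w x \<Delta> lam mu \<longleftrightarrow>
     0 \<le> mu 0 \<and>
     (\<forall>k.
       (\<exists>v \<in> subdiff (\<lambda>z. aug_lagr f A b g (\<sigma> k) z (lam k) (mu k)) (x (Suc k)).
          \<Delta> (Suc k) = v + (\<tau> k / \<sigma> k) *\<^sub>R (S *v (x (Suc k) - x k))) \<and>
       2 * \<bar>(w k - x (Suc k)) \<bullet> (\<sigma> k *\<^sub>R \<Delta> (Suc k))\<bar> + (norm (\<sigma> k *\<^sub>R \<Delta> (Suc k)))\<^sup>2
         \<le> \<rho> * ((norm (\<sigma> k *\<^sub>R (A *v x (Suc k) - b)))\<^sup>2
               + (norm (\<chi> i. min (mu k $ i) (- \<sigma> k * g (x (Suc k)) $ i)))\<^sup>2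
               + \<tau> k * (wnorm ((*v) S) (x (Suc k) - x k))\<^sup>2) \<and>
       lam (Suc k) = lam k + \<sigma> k *\<^sub>R (A *v x (Suc k) - b) \<and>
       mu (Suc k) = (\<chi> i. max 0 (mu k $ i + \<sigma> k * g (x (Suc k)) $ i)) \<and>
       w (Suc k) = w k - \<sigma> k *\<^sub>R \<Delta> (Suc k))"

end

theory Submission
  imports Defs
begin

text \<open>
  Write \<open>z = (x, y)\<close>. The multiplier updates make \<open>(p, u) = (\<Delta> - (\<tau>/\<sigma>) S (x' - x), (y - y') / \<sigma>)\<close> a
  subgradient of the Lagrangian at the new iterate \<open>z'\<close>, and the stopping criterion says
  \<open>\<parallel>\<sigma> \<Delta>\<parallel>\<^sup>2 \<le> \<rho> D\<^sup>2\<close> with \<open>D\<close> the weighted length of \<open>z' - z\<close>. Hence \<open>\<sigma> \<parallel>(p, u)\<parallel>\<close> is a multiple of \<open>D\<close>, and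
  the error bound controls the distance of \<open>z'\<close> to the saddle points by \<open>D / \<sigma>\<close>. Monotonicity
  against the weighted projection \<open>(P, Q)\<close> of \<open>z\<close> gives
  \<open>dist\<^sup>2(z') + D\<^sup>2 \<le> dist\<^sup>2(z) + 2 \<sigma> \<langle>\<Delta>, x' - P\<rangle>\<close>. The saddle set is a product of convex sets, so
  the projection splits and its first component is nonexpansive for the \<open>S\<close>-norm; with \<open>P'\<close> the
  projection of \<open>x'\<close>, splitting \<open>x' - P = (x' - P') + (P' - P)\<close> turns the last term into \<open>\<beta> D\<^sup>2\<close> with
  \<open>\<beta> < 1\<close>. The same inequality bounds \<open>D\<close> by \<open>dist(z)\<close>, so the steps are summable and \<open>x\<close> is Cauchy.
  Projections are taken onto the closure of the saddle set, which changes neither the distances nor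
  the monotonicity inequality.
\<close>

section \<open>Spectral bounds and projections for positive definite matrices\<close>

lemma inner_matrix_sym:
  fixes S :: "real^'n^'n"
  assumes "transpose S = S"
  shows "x \<bullet> (S *v y) = y \<bullet> (S *v x)"
  using assms by (metis dot_lmul_matrix inner_commute transpose_matrix_vector)

lemma quadratic_form_add:
  fixes S :: "real^'n^'n"
  assumes sym: "transpose S = S"
  shows "(x + t *\<^sub>R y) \<bullet> (S *v (x + t *\<^sub>R y)) =
    x \<bullet> (S *v x) + 2 * t * (x \<bullet> (S *v y)) + t\<^sup>2 * (y \<bullet> (S *v y))"
  using inner_matrix_sym[OF sym, of y x]
  by (simp add: matrix_vector_right_distrib matrix_vector_mult_scaleR inner_add
      power2_eq_square distrib_left)

text \<open>The form is nonnegative along the line \<open>x + t *\<^sub>R y\<close>; evaluate it at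
  the minimizing \<open>t = - b / c\<close>. Semidefiniteness suffices as hypothesis because the
  inequality is also applied to the singular matrix \<open>e I - S\<close> at an extremal eigenvalue
  \<open>e\<close>.\<close>

lemma psd_Cauchy_Schwarz:
  fixes S :: "real^'n^'n"
  assumes sym: "transpose S = S" and psd: "\<And>x. 0 \<le> x \<bullet> (S *v x)"
  shows "(x \<bullet> (S *v y))\<^sup>2 \<le> (x \<bullet> (S *v x)) * (y \<bullet> (S *v y))"
proof -
  let ?a = "x \<bullet> (S *v x)" and ?b = "x \<bullet> (S *v y)" and ?c = "y \<bullet> (S *v y)"
  have quad: "0 \<le> ?a + 2 * t * ?b + t\<^sup>2 * ?c" for t
    using psd[of "x + t *\<^sub>R y"] by (simp add: quadratic_form_add[OF sym])
  show ?thesis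
  proof (cases "?c = 0")
    case True
    have "?b = 0"
    proof (rule ccontr)
      assume b: "?b \<noteq> 0"
      \<comment> \<open>With \<open>c = 0\<close> the form is affine in \<open>t\<close>; this
        \<open>t\<close> makes it equal to \<open>-1\<close>.\<close>
      define t where "t = - (?a + 1) / (2 * ?b)"
      have "2 * t * ?b = - (?a + 1)" using b unfolding t_def by simp
      then show False using quad[of t] True by simp
    qed
    then show ?thesis using True by simp
  next
    case False
    then have pos: "?c > 0" using psd[of y] by linarith
    have "?a + 2 * (- ?b / ?c) * ?b + (- ?b / ?c)\<^sup>2 * ?c = (?a * ?c - ?b\<^sup>2) / ?c"
      using pos by (simp add: field_simps power2_eq_square)
    then have "0 \<le> (?a * ?c - ?b\<^sup>2) / ?c"
      using quad[of "- ?b / ?c"] by simp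
    then show ?thesis using pos by (simp add: zero_le_divide_iff)
  qed
qed

text \<open>Eigenvectors chosen for distinct eigenvalues are orthogonal, hence independent, hence
  finite in number. This makes the \<open>Min\<close> and \<open>Max\<close> in
  \<open>lambda_min\<close> and \<open>lambda_max\<close> meaningful.\<close>

lemma finite_eigvals:
  fixes S :: "real^'n^'n"
  assumes sym: "transpose S = S"
  shows "finite (eigvals S)"
proof -
  have "\<forall>e\<in>eigvals S. \<exists>v. v \<noteq> 0 \<and> S *v v = e *\<^sub>R v" by (auto simp: eigvals_def)
  from bchoice[OF this] obtain ev
    where ev: "\<And>e. e \<in> eigvals S \<Longrightarrow> ev e \<noteq> 0 \<and> S *v ev e = e *\<^sub>R ev e" by blast
  have orth: "ev d \<bullet> ev e = 0" if "d \<in> eigvals S" "e \<in> eigvals S" "d \<noteq> e" for d e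
    using inner_matrix_sym[OF sym, of "ev d" "ev e"] ev[OF that(1)] ev[OF that(2)] that(3)
    by (simp add: inner_commute)
  have "inj_on ev (eigvals S)"
    by (rule inj_onI) (metis orth ev inner_eq_zero_iff)
  moreover have "finite (ev ` eigvals S)"
  proof (rule independent_imp_finite, rule pairwise_orthogonal_independent)
    show "pairwise orthogonal (ev ` eigvals S)"
      unfolding pairwise_def orthogonal_def using orth by blast
    show "0 \<notin> ev ` eigvals S" using ev by force
  qed
  ultimately show ?thesis using finite_imageD by blast
qed

text \<open>A maximizer \<open>u\<close> of the form on the unit sphere is an eigenvector: for the
  maximum \<open>e\<close>, the matrix \<open>e I - S\<close> is positive semidefinite and its form
  vanishes at \<open>u\<close>, so Cauchy-Schwarz puts \<open>u\<close> in its kernel.\<close>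

lemma Rayleigh_max_eigval:
  fixes S :: "real^'n^'n"
  assumes sym: "transpose S = S"
  obtains e where "e \<in> eigvals S" "\<And>x. x \<bullet> (S *v x) \<le> e * (norm x)\<^sup>2"
proof -
  have cont: "continuous_on (sphere 0 1) (\<lambda>x. x \<bullet> (S *v x))"
    by (intro continuous_intros matrix_vector_mult_linear_continuous_on)
  obtain j :: "real^'n" where j: "norm j = 1" using vector_choose_size[of 1] by auto
  then have "sphere (0::real^'n) 1 \<noteq> {}" by (auto simp: dist_norm)
  then obtain u where u: "norm u = 1"
    and umax: "\<And>x. norm x = 1 \<Longrightarrow> x \<bullet> (S *v x) \<le> u \<bullet> (S *v u)"
    using continuous_attains_sup[OF compact_sphere _ cont] by (auto simp: dist_norm)
  define e where "e = u \<bullet> (S *v u)"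
  have bound: "x \<bullet> (S *v x) \<le> e * (norm x)\<^sup>2" for x
  proof (cases "x = 0")
    case False
    have "(x /\<^sub>R norm x) \<bullet> (S *v (x /\<^sub>R norm x)) \<le> e"
      unfolding e_def using False by (intro umax) simp
    then show ?thesis using False
      by (simp add: matrix_vector_mult_scaleR divide_simps power2_eq_square)
  qed simp
  define T where "T = e *\<^sub>R mat 1 - S"
  have Tv: "T *v x = e *\<^sub>R x - S *v x" for x
    unfolding T_def by (simp add: matrix_vector_mult_diff_rdistrib flip: scaleR_matrix_vector_assoc)
  have "transpose T = T"
    using sym unfolding T_def transpose_def by (simp add: vec_eq_iff mat_def)
  moreover have "0 \<le> x \<bullet> (T *v x)" for x
    using bound[of x] by (simp add: Tv inner_diff_right power2_norm_eq_inner)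
  \<comment> \<open>Cauchy-Schwarz for the pair \<open>T *v u\<close> and \<open>u\<close>: the left
    side is the fourth power of the norm of \<open>T *v u\<close>, and the last factor on the right
    is zero.\<close>
  ultimately have "((T *v u) \<bullet> (T *v u))\<^sup>2 \<le> ((T *v u) \<bullet> (T *v (T *v u))) * (u \<bullet> (T *v u))"
    by (rule psd_Cauchy_Schwarz)
  moreover have "u \<bullet> (T *v u) = 0"
    using u by (simp add: Tv inner_diff_right e_def flip: power2_norm_eq_inner)
  ultimately have "T *v u = 0" by simp
  then have "e \<in> eigvals S" using u unfolding eigvals_def Tv
    by (auto intro!: exI[of _ u])
  then show ?thesis using that bound by blast
qed

lemma lambda_max_bound:
  fixes S :: "real^'n^'n"
  assumes sym: "transpose S = S"
  shows "x \<bullet> (S *v x) \<le> lambda_max S * (norm x)\<^sup>2"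
proof -
  obtain e where e: "e \<in> eigvals S" "x \<bullet> (S *v x) \<le> e * (norm x)\<^sup>2"
    using Rayleigh_max_eigval[OF sym] by blast
  have "e \<le> lambda_max S"
    unfolding lambda_max_def using finite_eigvals[OF sym] e(1) by (rule Max_ge)
  then show ?thesis using e(2) by (meson mult_right_mono order_trans zero_le_power2)
qed

text \<open>The Rayleigh bound for \<open>- S\<close>, whose eigenvalues are those of
  \<open>S\<close> with the sign reversed.\<close>

lemma lambda_min_mem_bound:
  fixes S :: "real^'n^'n"
  assumes sym: "transpose S = S"
  shows "lambda_min S \<in> eigvals S" "lambda_min S * (norm x)\<^sup>2 \<le> x \<bullet> (S *v x)"
proof -
  have minus: "(- S) *v y = - (S *v y)" for y
    using matrix_vector_mult_diff_rdistrib[of 0 S y] by simp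
  have "transpose (- S) = - S" using sym by (simp add: transpose_def vec_eq_iff)
  then obtain e where e: "e \<in> eigvals (- S)" "x \<bullet> ((- S) *v x) \<le> e * (norm x)\<^sup>2"
    using Rayleigh_max_eigval by blast
  have mem: "- e \<in> eigvals S"
    using e(1) by (auto simp: eigvals_def minus) (metis minus_minus)
  then show "lambda_min S \<in> eigvals S"
    unfolding lambda_min_def using finite_eigvals[OF sym] by (intro Min_in) auto
  have "lambda_min S \<le> - e"
    unfolding lambda_min_def using finite_eigvals[OF sym] mem by (rule Min_le)
  then have "lambda_min S * (norm x)\<^sup>2 \<le> - e * (norm x)\<^sup>2" by (intro mult_right_mono) auto
  also have "\<dots> \<le> x \<bullet> (S *v x)" using e(2) by (simp add: minus)
  finally show "lambda_min S * (norm x)\<^sup>2 \<le> x \<bullet> (S *v x)" .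
qed

lemma sym_pos_defD:
  assumes "sym_pos_def S"
  shows "transpose S = S" "0 \<le> x \<bullet> (S *v x)"
  using assms unfolding sym_pos_def_def by (auto, cases "x = 0") (auto intro: less_imp_le)

lemma lambda_min_pos:
  assumes S: "sym_pos_def S"
  shows "0 < lambda_min S"
proof -
  obtain v where v: "v \<noteq> 0" "S *v v = lambda_min S *\<^sub>R v"
    using lambda_min_mem_bound(1)[OF sym_pos_defD(1)[OF S]] unfolding eigvals_def by blast
  then have "0 < v \<bullet> (S *v v)" using S unfolding sym_pos_def_def by blast
  then show ?thesis using v inner_ge_zero[of v]
    by (auto simp: zero_less_mult_iff simp del: inner_ge_zero)
qed

text \<open>Cauchy-Schwarz in the form of \<open>S\<close> for the pair \<open>S *v x\<close> and
  \<open>x\<close>, followed by \<open>lambda_max_bound\<close> at \<open>S *v x\<close> and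
  division by its squared norm.\<close>

lemma norm_mult_le_lambda_max:
  assumes S: "sym_pos_def S"
  shows "(norm (S *v x))\<^sup>2 \<le> lambda_max S * (x \<bullet> (S *v x))"
proof (cases "S *v x = 0")
  case False
  let ?y = "S *v x"
  have "((norm ?y)\<^sup>2)\<^sup>2 = (?y \<bullet> (S *v x))\<^sup>2" by (simp add: power2_norm_eq_inner)
  also have "\<dots> \<le> (?y \<bullet> (S *v ?y)) * (x \<bullet> (S *v x))"
    using S by (intro psd_Cauchy_Schwarz sym_pos_defD)
  also have "\<dots> \<le> (lambda_max S * (norm ?y)\<^sup>2) * (x \<bullet> (S *v x))"
    by (intro mult_right_mono lambda_max_bound sym_pos_defD S)
  finally have "(norm ?y)\<^sup>2 * (norm ?y)\<^sup>2 \<le> (lambda_max S * (x \<bullet> (S *v x))) * (norm ?y)\<^sup>2"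
    by (simp add: power2_eq_square[of "(norm _)\<^sup>2"] mult_ac)
  then show ?thesis using False by (subst (asm) mult_le_cancel_right) auto
qed simp

lemma lambda_max_pos:
  fixes S :: "real^'n^'n"
  assumes S: "sym_pos_def S"
  shows "0 < lambda_max S"
proof -
  obtain j :: "real^'n" where j: "norm j = 1" using vector_choose_size[of 1] by auto
  then have "j \<noteq> 0" by auto
  then have "0 < j \<bullet> (S *v j)" using S unfolding sym_pos_def_def by blast
  also have "\<dots> \<le> lambda_max S * (norm j)\<^sup>2" by (intro lambda_max_bound sym_pos_defD S)
  finally show ?thesis using j by simp
qed

lemma psd_triangle:
  fixes S :: "real^'n^'n"
  assumes sym: "transpose S = S" and psd: "\<And>x. 0 \<le> x \<bullet> (S *v x)"
  shows "sqrt ((x + y) \<bullet> (S *v (x + y))) \<le> sqrt (x \<bullet> (S *v x)) + sqrt (y \<bullet> (S *v y))"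
proof (rule real_le_lsqrt)
  let ?a = "x \<bullet> (S *v x)" and ?b = "x \<bullet> (S *v y)" and ?c = "y \<bullet> (S *v y)"
  show "0 \<le> sqrt ?a + sqrt ?c" using psd by simp
  have "?b \<le> sqrt (?a * ?c)"
    using psd_Cauchy_Schwarz[OF sym psd, of x y] by (rule real_le_rsqrt)
  then show "(x + y) \<bullet> (S *v (x + y)) \<le> (sqrt ?a + sqrt ?c)\<^sup>2"
    using quadratic_form_add[OF sym, of x 1 y] psd[of x] psd[of y]
    by (simp add: power2_sum real_sqrt_mult)
qed

text \<open>Candidates at least as good as a fixed \<open>c0\<close> lie in a ball around
  \<open>x\<close>, so the minimum is attained on a compact part of \<open>C\<close>.\<close>

lemma spd_projection_exists:
  fixes C :: "(real^'n) set"
  assumes S: "sym_pos_def S" and C: "closed C" "C \<noteq> {}"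
  obtains p where "p \<in> C" "\<And>c. c \<in> C \<Longrightarrow> (x - p) \<bullet> (S *v (x - p)) \<le> (x - c) \<bullet> (S *v (x - c))"
proof -
  let ?q = "\<lambda>c. (x - c) \<bullet> (S *v (x - c))"
  obtain c0 where c0: "c0 \<in> C" using C(2) by blast
  \<comment> \<open>The radius comes from bounding the form below by \<open>lambda_min S\<close>
    times the squared Euclidean norm.\<close>
  define R where "R = sqrt (?q c0 / lambda_min S)"
  have near: "c \<in> cball x R" if "?q c \<le> ?q c0" for c
  proof -
    have "lambda_min S * (norm (x - c))\<^sup>2 \<le> ?q c0"
      using lambda_min_mem_bound(2)[OF sym_pos_defD(1)[OF S], of "x - c"] that by linarith
    then have "(norm (x - c))\<^sup>2 \<le> ?q c0 / lambda_min S"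
      using lambda_min_pos[OF S] by (simp add: field_simps)
    then show ?thesis unfolding R_def by (simp add: dist_norm real_le_rsqrt)
  qed
  have "compact (C \<inter> cball x R)" using C(1) by (intro closed_Int_compact compact_cball)
  moreover have "c0 \<in> C \<inter> cball x R" using c0 near by blast
  moreover have "continuous_on (C \<inter> cball x R) ?q"
    by (intro continuous_intros continuous_on_compose2[OF matrix_vector_mult_linear_continuous_on[of UNIV]]) auto
  ultimately obtain p where p: "p \<in> C \<inter> cball x R" "\<And>c. c \<in> C \<inter> cball x R \<Longrightarrow> ?q p \<le> ?q c"
    using continuous_attains_inf[of "C \<inter> cball x R" ?q] by blast
  have "?q p \<le> ?q c" if "c \<in> C" for c
  proof (cases "?q c \<le> ?q c0")
    case True
    then show ?thesis using p(2) that near by blast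
  next
    case False
    then show ?thesis using p(2)[of c0] \<open>c0 \<in> C \<inter> cball x R\<close> by linarith
  qed
  then show ?thesis using that p(1) by blast
qed

text \<open>First-order optimality of the projection: compare \<open>p\<close> with
  \<open>(1 - t) *\<^sub>R p + t *\<^sub>R c\<close>, divide by \<open>t\<close> and let
  \<open>t\<close> decrease to 0.\<close>

lemma spd_projection_obtuse:
  assumes S: "sym_pos_def S" and C: "convex C" "p \<in> C" "c \<in> C"
    and min: "\<And>c. c \<in> C \<Longrightarrow> (x - p) \<bullet> (S *v (x - p)) \<le> (x - c) \<bullet> (S *v (x - c))"
  shows "(x - p) \<bullet> (S *v (c - p)) \<le> 0"
proof -
  let ?a = "(x - p) \<bullet> (S *v (c - p))" and ?b = "(c - p) \<bullet> (S *v (c - p))"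
  note sym = sym_pos_defD(1)[OF S]
  have ineq: "2 * ?a \<le> t * ?b" if t: "0 < t" "t \<le> 1" for t
  proof -
    have "(1 - t) *\<^sub>R p + t *\<^sub>R c \<in> C"
      using C t by (intro convexD) auto
    then have "(x - p) \<bullet> (S *v (x - p)) \<le> (x - ((1 - t) *\<^sub>R p + t *\<^sub>R c)) \<bullet> (S *v (x - ((1 - t) *\<^sub>R p + t *\<^sub>R c)))"
      by (rule min)
    also have "x - ((1 - t) *\<^sub>R p + t *\<^sub>R c) = (x - p) + (- t) *\<^sub>R (c - p)"
      by (simp add: algebra_simps)
    also have "\<dots> \<bullet> (S *v \<dots>) = (x - p) \<bullet> (S *v (x - p)) - 2 * t * ?a + t\<^sup>2 * ?b"
      by (simp only: quadratic_form_add[OF sym]) simp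
    finally have "t * (2 * ?a) \<le> t * (t * ?b)" by (simp add: power2_eq_square)
    then show ?thesis using t by (simp add: mult_le_cancel_left)
  qed
  have "((\<lambda>t. t * ?b) \<longlongrightarrow> 0 * ?b) (at_right 0)" by (intro tendsto_intros)
  moreover have "\<forall>\<^sub>F t in at_right 0. 2 * ?a \<le> t * ?b"
    using ineq by (auto simp: eventually_at_right_less intro!: eventually_at_rightI[of 0 1])
  ultimately have "2 * ?a \<le> 0 * ?b"
    by (intro tendsto_lowerbound[of "\<lambda>t. t * ?b"]) auto
  then show ?thesis by simp
qed

text \<open>Adding the obtuse-angle inequalities at \<open>p\<close> and \<open>p'\<close> bounds
  the form at \<open>p' - p\<close> by its mixed value with \<open>x' - x\<close>; Cauchy-Schwarz
  finishes.\<close>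

lemma spd_projection_nonexpansive:
  assumes S: "sym_pos_def S" and C: "convex C" "p \<in> C" "p' \<in> C"
    and min: "\<And>c. c \<in> C \<Longrightarrow> (x - p) \<bullet> (S *v (x - p)) \<le> (x - c) \<bullet> (S *v (x - c))"
    and min': "\<And>c. c \<in> C \<Longrightarrow> (x' - p') \<bullet> (S *v (x' - p')) \<le> (x' - c) \<bullet> (S *v (x' - c))"
  shows "(p' - p) \<bullet> (S *v (p' - p)) \<le> (x' - x) \<bullet> (S *v (x' - x))"
proof -
  let ?a = "(p' - p) \<bullet> (S *v (p' - p))" and ?b = "(x' - x) \<bullet> (S *v (x' - x))"
  note spd = sym_pos_defD[OF S]
  have "(x - p) \<bullet> (S *v (p' - p)) \<le> 0" "(x' - p') \<bullet> (S *v (p - p')) \<le> 0"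
    using spd_projection_obtuse[OF S] C min min' by blast+
  then have le: "?a \<le> (x' - x) \<bullet> (S *v (p' - p))"
    by (simp add: matrix_vector_mult_diff_distrib inner_diff algebra_simps)
  have "?a * ?a \<le> ((x' - x) \<bullet> (S *v (p' - p)))\<^sup>2"
    using le spd(2)[of "p' - p"] by (simp add: power2_eq_square mult_mono)
  also have "\<dots> \<le> ?b * ?a" by (rule psd_Cauchy_Schwarz[OF spd])
  finally show ?thesis using spd(2)[of "p' - p"] spd(2)[of "x' - x"]
    by (cases "?a = 0") (auto simp: mult_le_cancel_right)
qed

section \<open>Saddle points and subgradients of the Lagrangian\<close>

text \<open>The infimum runs over \<open>Z\<close>, while the minimizer is only in its closure.
  Points of \<open>Z\<close> converging to \<open>zb\<close> show by continuity of \<open>H\<close>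
  that both values agree.\<close>

lemma wdist_eq_closure_minimizer:
  assumes Z: "zb \<in> closure Z" and min: "\<And>c. c \<in> Z \<Longrightarrow> wnorm H (z - zb) \<le> wnorm H (z - c)"
    and cont: "continuous_on UNIV H"
  shows "wdist H z Z = ereal (wnorm H (z - zb))"
  unfolding wdist_def
proof (rule antisym)
  show "ereal (wnorm H (z - zb)) \<le> (INF c\<in>Z. ereal (wnorm H (z - c)))"
    using min by (intro INF_greatest) auto
  obtain s where s: "\<And>n. s n \<in> Z" "s \<longlonglongrightarrow> zb" using Z unfolding closure_sequential by blast
  have "isCont H (z - zb)" using cont continuous_on_eq_continuous_at open_UNIV by blast
  moreover have lim: "(\<lambda>n. z - s n) \<longlonglongrightarrow> z - zb" using s(2) by (intro tendsto_diff tendsto_const)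
  ultimately have "(\<lambda>n. H (z - s n)) \<longlonglongrightarrow> H (z - zb)" by (rule isCont_tendsto_compose)
  with lim have "(\<lambda>n. wnorm H (z - s n)) \<longlonglongrightarrow> wnorm H (z - zb)"
    unfolding wnorm_def by (intro tendsto_real_sqrt tendsto_inner)
  then have lim': "(\<lambda>n. ereal (wnorm H (z - s n))) \<longlonglongrightarrow> ereal (wnorm H (z - zb))" by simp
  then show "(INF c\<in>Z. ereal (wnorm H (z - c))) \<le> ereal (wnorm H (z - zb))"
    by (rule tendsto_lowerbound[OF _ _ sequentially_bot])
      (auto intro!: always_eventually INF_lower s(1))
qed

text \<open>Passing to the closure makes the infimum attained, so the bound \<open>e\<close> is
  reached without an additional epsilon.\<close>

lemma edist_le_imp_closure_point:
  fixes Z :: "'a::heine_borel set"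
  assumes "Z \<noteq> {}" and le: "edist z Z \<le> ereal e"
  obtains c where "c \<in> closure Z" "dist z c \<le> e"
proof -
  obtain c where c: "c \<in> closure Z" "\<And>y. y \<in> closure Z \<Longrightarrow> dist z c \<le> dist z y"
    using distance_attains_inf[of "closure Z" z] assms(1) by auto
  have "ereal (dist z c) \<le> edist z Z"
    unfolding edist_def using c(2) closure_subset by (intro INF_greatest) (auto simp: subset_iff)
  then have "ereal (dist z c) \<le> ereal e" using le by (rule order_trans)
  then show ?thesis using that c(1) by simp
qed

lemma saddle_points_iff:
  "(x, y) \<in> saddle_points l \<longleftrightarrow> (\<forall>x'. l x y \<le> l x' y) \<and> (\<forall>y'. l x y' \<le> l x y)"
  by (simp add: saddle_subdiff_inv_def saddle_subdiff_def flip: zero_ereal_def)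

text \<open>Any two saddle points have the same value, by the cycle
  \<open>l x y \<le> l x0 y \<le> l x0 y0 \<le> l x y0 \<le> l x y\<close>. The saddle conditions
  then separate into one on \<open>x\<close> and one on \<open>y\<close>.\<close>

lemma saddle_points_product:
  assumes xy: "(x0, y0) \<in> saddle_points l"
  shows "saddle_points l = {x. \<forall>y. l x y \<le> l x0 y0} \<times> {y. \<forall>x. l x0 y0 \<le> l x y}"
proof (intro set_eqI iffI)
  fix z assume z: "z \<in> saddle_points l"
  obtain x y where [simp]: "z = (x, y)" by (cases z)
  have sp: "\<And>x'. l x y \<le> l x' y" "\<And>y'. l x y' \<le> l x y"
    using z by (simp_all add: saddle_points_iff)
  have sp0: "\<And>x'. l x0 y0 \<le> l x' y0" "\<And>y'. l x0 y' \<le> l x0 y0"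
    using xy by (simp_all add: saddle_points_iff)
  have "l x y = l x0 y0"
    using sp(1)[of x0] sp0(2)[of y] sp0(1)[of x] sp(2)[of y0] by order
  then show "z \<in> {x. \<forall>y. l x y \<le> l x0 y0} \<times> {y. \<forall>x. l x0 y0 \<le> l x y}"
    using sp by simp
next
  fix z assume z: "z \<in> {x. \<forall>y. l x y \<le> l x0 y0} \<times> {y. \<forall>x. l x0 y0 \<le> l x y}"
  obtain x y where [simp]: "z = (x, y)" by (cases z)
  have "l x y = l x0 y0" using z by (auto intro: order_antisym)
  then show "z \<in> saddle_points l" using z by (auto simp: saddle_points_iff)
qed

text \<open>Comparison with the zero multiplier excludes \<open>-\<infinity>\<close>, and comparison
  with a point of the domain of \<open>f\<close> excludes \<open>\<infinity>\<close>.\<close>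

lemma saddle_value_finite:
  assumes f: "proper_fun f" and xy: "(x0, y0) \<in> saddle_points (lagr f A b g)"
  shows "\<bar>lagr f A b g x0 y0\<bar> \<noteq> \<infinity>"
proof -
  have x0: "f x0 \<noteq> -\<infinity>" using f unfolding proper_fun_def by blast
  have "lagr f A b g x0 (0, 0) \<le> lagr f A b g x0 y0" using xy unfolding saddle_points_iff by blast
  then have 1: "lagr f A b g x0 y0 \<noteq> -\<infinity>" using x0 by (auto simp: lagr_def)
  obtain x1 where "f x1 \<noteq> \<infinity>" using f unfolding proper_fun_def by blast
  then have "lagr f A b g x1 y0 \<noteq> \<infinity>" by (auto simp: lagr_def split: prod.splits)
  moreover have "lagr f A b g x0 y0 \<le> lagr f A b g x1 y0" using xy unfolding saddle_points_iff by blast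
  ultimately show ?thesis using 1 by auto
qed

lemma convex_fun_segment:
  assumes "convex_fun f" "f x \<le> ereal a" "f y \<le> ereal b" "0 \<le> t" "t \<le> 1"
  shows "f ((1 - t) *\<^sub>R x + t *\<^sub>R y) \<le> ereal ((1 - t) * a + t * b)"
proof -
  have "(1 - t) *\<^sub>R (x, a) + t *\<^sub>R (y, b) \<in> {(x, t). f x \<le> ereal t}"
    using assms unfolding convex_fun_def by (intro convexD) auto
  then show ?thesis by simp
qed

lemma inner_convex_segment:
  fixes g :: "real^'n \<Rightarrow> real^'m"
  assumes g: "\<And>i. convex_on UNIV (\<lambda>x. g x $ i)" and mu: "0 \<le> mu" and t: "0 \<le> t" "t \<le> 1"
  shows "mu \<bullet> g ((1 - t) *\<^sub>R x + t *\<^sub>R y) \<le> (1 - t) * (mu \<bullet> g x) + t * (mu \<bullet> g y)"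
proof -
  have "mu $ i * g ((1 - t) *\<^sub>R x + t *\<^sub>R y) $ i \<le> mu $ i * ((1 - t) * g x $ i + t * g y $ i)" for i
    using convex_onD[OF g] mu t by (intro mult_left_mono) (auto simp: less_eq_vec_def)
  then have "mu \<bullet> g ((1 - t) *\<^sub>R x + t *\<^sub>R y) \<le> (\<Sum>i\<in>UNIV. mu $ i * ((1 - t) * g x $ i + t * g y $ i))"
    by (simp add: inner_vec_def sum_mono)
  also have "\<dots> = (1 - t) * (mu \<bullet> g x) + t * (mu \<bullet> g y)"
    by (simp add: inner_vec_def sum_distrib_left sum.distrib distrib_left mult_ac)
  finally show ?thesis .
qed

text \<open>For a nonnegative multiplier the condition reads \<open>f x \<le> v - h x\<close> with
  \<open>h\<close> real-valued and convex; otherwise the Lagrangian is \<open>-\<infinity>\<close>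
  and the set is the whole space.\<close>

lemma convex_lagr_sublevel:
  fixes g :: "real^'n \<Rightarrow> real^'m"
  assumes f: "convex_fun f" and g: "\<And>i. convex_on UNIV (\<lambda>x. g x $ i)"
  shows "convex {x. lagr f A b g x y \<le> ereal v}"
proof (cases "0 \<le> snd y")
  case True
  obtain lam mu where y: "y = (lam, mu)" and mu: "0 \<le> mu" using True by (cases y) auto
  define h where "h x = lam \<bullet> (A *v x - b) + mu \<bullet> g x" for x
  have iff: "lagr f A b g x y \<le> ereal v \<longleftrightarrow> f x \<le> ereal (v - h x)" for x
    using mu by (cases "f x") (auto simp: lagr_def y h_def)
  have "f (x + t *\<^sub>R (z - x)) \<le> ereal (v - h (x + t *\<^sub>R (z - x)))"
    if "f x \<le> ereal (v - h x)" "f z \<le> ereal (v - h z)" and t: "0 \<le> t" "t \<le> 1" for x z t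
  proof -
    let ?w = "(1 - t) *\<^sub>R x + t *\<^sub>R z"
    have "A *v ?w - b = (1 - t) *\<^sub>R (A *v x - b) + t *\<^sub>R (A *v z - b)"
      by (simp add: matrix_vector_right_distrib matrix_vector_mult_scaleR algebra_simps)
    then have "lam \<bullet> (A *v ?w - b) = (1 - t) * (lam \<bullet> (A *v x - b)) + t * (lam \<bullet> (A *v z - b))"
      by (simp add: inner_add_right)
    then have "h ?w \<le> (1 - t) * h x + t * h z"
      unfolding h_def using inner_convex_segment[OF g mu t] by (simp add: algebra_simps)
    then have "ereal ((1 - t) * (v - h x) + t * (v - h z)) \<le> ereal (v - h ?w)"
      by (simp add: algebra_simps)
    then have "f ?w \<le> ereal (v - h ?w)"
      using convex_fun_segment[OF f that] by (rule order_trans[rotated])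
    moreover have "?w = x + t *\<^sub>R (z - x)" by (simp add: algebra_simps)
    ultimately show ?thesis by simp
  qed
  then show ?thesis unfolding iff convex_alt by (simp add: algebra_simps)
next
  case False
  then have "lagr f A b g x y = -\<infinity>" for x by (cases y) (auto simp: lagr_def)
  then show ?thesis by simp
qed

text \<open>The function \<open>(max 0 s)\<^sup>2\<close> is nondecreasing with derivative
  \<open>2 * max 0 s\<close>, which is 2-Lipschitz. This is its quadratic upper bound, for
  \<open>d\<close> of either sign.\<close>

lemma max_0_square_bound:
  fixes s s' d :: real
  assumes "s' \<le> s + d"
  shows "(max 0 s')\<^sup>2 \<le> (max 0 s)\<^sup>2 + 2 * max 0 s * d + d\<^sup>2"
proof -
  have "(max 0 s')\<^sup>2 \<le> (max 0 (s + d))\<^sup>2" using assms by (intro power_mono) auto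
  also have "\<dots> \<le> (max 0 s)\<^sup>2 + 2 * max 0 s * d + d\<^sup>2"
  proof (cases "0 \<le> s")
    case True
    have "(max 0 (s + d))\<^sup>2 \<le> (s + d)\<^sup>2" by (auto simp: max_def)
    then show ?thesis using True by (simp add: power2_eq_square algebra_simps)
  next
    case False
    then have "max 0 (s + d) \<le> \<bar>d\<bar>" by auto
    then have "(max 0 (s + d))\<^sup>2 \<le> \<bar>d\<bar>\<^sup>2" by (intro power_mono) auto
    then show ?thesis using False by simp
  qed
  finally show ?thesis .
qed

text \<open>The subgradient inequality at a point of the domain of \<open>f\<close> would fail if
  \<open>f x\<close> were \<open>\<infinity>\<close>.\<close>

lemma aug_lagr_subdiff_finite:
  assumes f: "proper_fun f" and v: "v \<in> subdiff (\<lambda>z. aug_lagr f A b g \<sigma> z lam mu) x"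
  shows "\<bar>f x\<bar> \<noteq> \<infinity>"
proof -
  obtain x1 where "f x1 \<noteq> \<infinity>" using f unfolding proper_fun_def by blast
  moreover have "aug_lagr f A b g \<sigma> x lam mu + ereal (v \<bullet> (x1 - x)) \<le> aug_lagr f A b g \<sigma> x1 lam mu"
    using v unfolding subdiff_def by blast
  ultimately have "f x \<noteq> \<infinity>" by (auto simp: aug_lagr_def)
  then show ?thesis using f unfolding proper_fun_def by auto
qed

text \<open>A quadratic upper bound for the smooth part along the segment to \<open>x'\<close> replaces the
  subdifferential sum rule.\<close>

lemma aug_lagr_subdiff_lagr:
  fixes g :: "real^'n \<Rightarrow> real^'m2" and A :: "real^'n^'m1"
  assumes f: "proper_fun f" "convex_fun f" and g: "\<And>i. convex_on UNIV (\<lambda>x. g x $ i)"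
    and \<sigma>: "0 < \<sigma>"
    and v: "v \<in> subdiff (\<lambda>z. aug_lagr f A b g \<sigma> z lam mu) x"
    and lam': "lam' = lam + \<sigma> *\<^sub>R (A *v x - b)"
    and mu': "mu' = (\<chi> i. max 0 (mu $ i + \<sigma> * g x $ i))"
  shows "v \<in> subdiff (\<lambda>z. lagr f A b g z (lam', mu')) x"
proof -
  have "lagr f A b g x (lam', mu') + ereal (v \<bullet> (x' - x)) \<le> lagr f A b g x' (lam', mu')" for x'
  proof (cases "f x' = \<infinity>")
    case True
    then show ?thesis unfolding mu' by (simp add: lagr_def less_eq_vec_def)
  next
    case False
    obtain a where a: "f x = ereal a" using aug_lagr_subdiff_finite[OF f(1) v] by auto
    obtain a' where a': "f x' = ereal a'" using False f(1) unfolding proper_fun_def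
      by (metis MInfty_eq_minfinity PInfty_eq_infinity ereal.exhaust)
    \<comment> \<open>\<open>L\<close> collects the first-order change of the smooth part, with the
      difference of \<open>g\<close> in place of its derivative; \<open>K\<close> is the coefficient
      of the quadratic remainder.\<close>
    define K where "K = \<sigma> / 2 * (norm (A *v (x' - x)))\<^sup>2 + 1 / (2 * \<sigma>) * (norm (\<sigma> *\<^sub>R (g x' - g x)))\<^sup>2"
    define L where "L = lam' \<bullet> (A *v (x' - x)) + mu' \<bullet> (g x' - g x)"
    \<comment> \<open>The subgradient inequality is used at the intermediate point \<open>w\<close>,
      where all changes are of order \<open>t\<close>. After division by \<open>t\<close> the
      remainder is \<open>t * K\<close>, which vanishes as \<open>t\<close> tends to 0.\<close>
    have ineq: "v \<bullet> (x' - x) \<le> a' - a + L + t * K" if t: "0 < t" "t \<le> 1" for t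
    proof -
      define w where "w = (1 - t) *\<^sub>R x + t *\<^sub>R x'"
      have wx: "w - x = t *\<^sub>R (x' - x)" unfolding w_def by (simp add: algebra_simps)
      have Aw: "A *v w - b = (A *v x - b) + t *\<^sub>R (A *v (x' - x))"
      proof -
        have "A *v (w - x) = t *\<^sub>R (A *v (x' - x))" unfolding wx by (simp add: matrix_vector_mult_scaleR)
        then show ?thesis by (simp add: matrix_vector_mult_diff_distrib algebra_simps)
      qed
      \<comment> \<open>An exact expansion: the cross term of the square turns \<open>lam\<close>
        into the updated multiplier \<open>lam'\<close>.\<close>
      have n1: "lam \<bullet> (A *v w - b) + \<sigma> / 2 * (norm (A *v w - b))\<^sup>2 =
        lam \<bullet> (A *v x - b) + \<sigma> / 2 * (norm (A *v x - b))\<^sup>2 + t * (lam' \<bullet> (A *v (x' - x)))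
        + t\<^sup>2 * (\<sigma> / 2 * (norm (A *v (x' - x)))\<^sup>2)"
      proof -
        define p q where "p = A *v x - b" and "q = A *v (x' - x)"
        show ?thesis
          unfolding Aw lam' p_def[symmetric] q_def[symmetric] power2_norm_eq_inner
          by (simp add: inner_add_left inner_add_right inner_commute[of q p] power2_eq_square field_simps)
      qed
      let ?m = "\<lambda>z. \<chi> i. max 0 (mu $ i + \<sigma> * g z $ i)"
      have "(norm (?m w))\<^sup>2 = (\<Sum>i\<in>UNIV. (max 0 (mu $ i + \<sigma> * g w $ i))\<^sup>2)"
        unfolding power2_norm_eq_inner by (simp add: inner_vec_def power2_eq_square)
      also have "\<dots> \<le> (\<Sum>i\<in>UNIV. (mu' $ i)\<^sup>2 + 2 * mu' $ i * (t * \<sigma> * (g x' $ i - g x $ i))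
          + (t * \<sigma> * (g x' $ i - g x $ i))\<^sup>2)"
      proof (rule sum_mono)
        fix i
        have "g w $ i \<le> (1 - t) * g x $ i + t * g x' $ i"
          unfolding w_def using t by (intro convex_onD[OF g]) auto
        then have "\<sigma> * g w $ i \<le> \<sigma> * ((1 - t) * g x $ i + t * g x' $ i)"
          using \<sigma> by (intro mult_left_mono) auto
        then have "mu $ i + \<sigma> * g w $ i \<le> (mu $ i + \<sigma> * g x $ i) + t * \<sigma> * (g x' $ i - g x $ i)"
          by (simp add: algebra_simps)
        from max_0_square_bound[OF this]
        show "(max 0 (mu $ i + \<sigma> * g w $ i))\<^sup>2 \<le> (mu' $ i)\<^sup>2 + 2 * mu' $ i * (t * \<sigma> * (g x' $ i - g x $ i))
          + (t * \<sigma> * (g x' $ i - g x $ i))\<^sup>2"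
          unfolding mu' by simp
      qed
      also have "\<dots> = (norm mu')\<^sup>2 + 2 * \<sigma> * (t * (mu' \<bullet> (g x' - g x))) + t\<^sup>2 * (norm (\<sigma> *\<^sub>R (g x' - g x)))\<^sup>2"
        unfolding power2_norm_eq_inner
        by (simp add: inner_vec_def power2_eq_square sum.distrib sum_distrib_left mult_ac)
      finally have "1 / (2 * \<sigma>) * (norm (?m w))\<^sup>2 \<le> 1 / (2 * \<sigma>) *
          ((norm mu')\<^sup>2 + 2 * \<sigma> * (t * (mu' \<bullet> (g x' - g x))) + t\<^sup>2 * (norm (\<sigma> *\<^sub>R (g x' - g x)))\<^sup>2)"
        using \<sigma> by (intro mult_left_mono) auto
      also have "\<dots> = 1 / (2 * \<sigma>) * (norm mu')\<^sup>2 + t * (mu' \<bullet> (g x' - g x))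
          + t\<^sup>2 * (1 / (2 * \<sigma>) * (norm (\<sigma> *\<^sub>R (g x' - g x)))\<^sup>2)"
        using \<sigma> by (simp add: distrib_left)
      finally have n2: "1 / (2 * \<sigma>) * (norm (?m w))\<^sup>2 \<le> \<dots>" .
      have fw: "f w \<le> ereal ((1 - t) * a + t * a')"
        unfolding w_def using t a a' by (intro convex_fun_segment[OF f(2)]) auto
      then obtain d where d: "f w = ereal d" "d \<le> (1 - t) * a + t * a'"
        using f(1) unfolding proper_fun_def by (cases "f w") auto
      have "aug_lagr f A b g \<sigma> x lam mu + ereal (v \<bullet> (w - x)) \<le> aug_lagr f A b g \<sigma> w lam mu"
        using v unfolding subdiff_def by blast
      then have "a + (lam \<bullet> (A *v x - b) + \<sigma> / 2 * (norm (A *v x - b))\<^sup>2) + 1 / (2 * \<sigma>) * (norm mu')\<^sup>2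
          + t * (v \<bullet> (x' - x)) \<le> d + (lam \<bullet> (A *v w - b) + \<sigma> / 2 * (norm (A *v w - b))\<^sup>2)
          + 1 / (2 * \<sigma>) * (norm (?m w))\<^sup>2"
        unfolding wx mu' by (simp add: aug_lagr_def a d)
      also have "\<dots> \<le> ((1 - t) * a + t * a') + (lam \<bullet> (A *v w - b) + \<sigma> / 2 * (norm (A *v w - b))\<^sup>2)
          + (1 / (2 * \<sigma>) * (norm mu')\<^sup>2 + t * (mu' \<bullet> (g x' - g x))
          + t\<^sup>2 * (1 / (2 * \<sigma>) * (norm (\<sigma> *\<^sub>R (g x' - g x)))\<^sup>2))"
        using d(2) n2 by linarith
      finally have "t * (v \<bullet> (x' - x)) \<le> t * (a' - a + L + t * K)"
        unfolding n1 L_def K_def by (simp add: power2_eq_square algebra_simps)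
      then show ?thesis using t by (simp add: mult_le_cancel_left)
    qed
    have "((\<lambda>t. a' - a + L + t * K) \<longlongrightarrow> a' - a + L + 0 * K) (at_right 0)"
      by (intro tendsto_intros)
    moreover have "\<forall>\<^sub>F t in at_right 0. v \<bullet> (x' - x) \<le> a' - a + L + t * K"
      using ineq by (intro eventually_at_rightI[of 0 1]) auto
    ultimately have "v \<bullet> (x' - x) \<le> a' - a + L + 0 * K"
      by (intro tendsto_lowerbound) auto
    then have "a + lam' \<bullet> (A *v x - b) + mu' \<bullet> g x + v \<bullet> (x' - x) \<le> a' + lam' \<bullet> (A *v x' - b) + mu' \<bullet> g x'"
      unfolding L_def by (simp add: matrix_vector_mult_diff_distrib inner_diff_right)
    moreover have "0 \<le> mu'" unfolding mu' by (simp add: less_eq_vec_def)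
    ultimately show ?thesis by (simp add: lagr_def a a')
  qed
  then show ?thesis unfolding subdiff_def by blast
qed

text \<open>The component \<open>mu'\<close> is the projection of \<open>mu + \<sigma> g(x)\<close>
  onto the nonnegative orthant, and \<open>(mu - mu') / \<sigma>\<close> differs from
  \<open>- g x\<close> by a normal vector there. In \<open>lam\<close> the Lagrangian is affine, so
  equality holds.\<close>

lemma multiplier_step_subdiff:
  fixes g :: "real^'n \<Rightarrow> real^'m2" and A :: "real^'n^'m1"
  assumes fx: "\<bar>f x\<bar> \<noteq> \<infinity>" and \<sigma>: "0 < \<sigma>"
    and lam': "lam' = lam + \<sigma> *\<^sub>R (A *v x - b)"
    and mu': "mu' = (\<chi> i. max 0 (mu $ i + \<sigma> * g x $ i))"
  shows "lagr f A b g x y' \<le> lagr f A b g x (lam', mu')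
    - ereal (((1 / \<sigma>) *\<^sub>R ((lam, mu) - (lam', mu'))) \<bullet> (y' - (lam', mu')))"
proof -
  obtain a where a: "f x = ereal a" using fx by auto
  obtain la m where y': "y' = (la, m)" by (cases y')
  have mu0: "0 \<le> mu'" unfolding mu' by (simp add: less_eq_vec_def)
  show ?thesis
  proof (cases "0 \<le> m")
    case False
    then show ?thesis using mu0 a by (simp add: y' lagr_def)
  next
    case True
    have "(m $ i - mu' $ i) * g x $ i \<le> - ((mu $ i - mu' $ i) / \<sigma>) * (m $ i - mu' $ i)" for i
    proof -
      have mi: "0 \<le> m $ i" using True by (simp add: less_eq_vec_def)
      \<comment> \<open>The variational inequality of the projection onto the half-line, one
        coordinate at a time.\<close>
      have "0 \<le> (mu' $ i - (mu $ i + \<sigma> * g x $ i)) * (m $ i - mu' $ i)"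
        unfolding mu' using mi by (auto simp: max_def zero_le_mult_iff)
      then have "0 \<le> ((mu' $ i - (mu $ i + \<sigma> * g x $ i)) * (m $ i - mu' $ i)) / \<sigma>"
        using \<sigma> by simp
      also have "\<dots> = - ((mu $ i - mu' $ i) / \<sigma>) * (m $ i - mu' $ i) - (m $ i - mu' $ i) * g x $ i"
        using \<sigma> by (simp add: field_simps)
      finally show ?thesis by simp
    qed
    then have "(\<Sum>i\<in>UNIV. (m $ i - mu' $ i) * g x $ i)
        \<le> (\<Sum>i\<in>UNIV. - ((mu $ i - mu' $ i) / \<sigma>) * (m $ i - mu' $ i))"
      by (rule sum_mono)
    then have 1: "(m - mu') \<bullet> g x \<le> - (((1 / \<sigma>) *\<^sub>R (mu - mu')) \<bullet> (m - mu'))"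
      by (simp add: inner_vec_def sum_negf)
    have 2: "(la - lam') \<bullet> (A *v x - b) = - (((1 / \<sigma>) *\<^sub>R (lam - lam')) \<bullet> (la - lam'))"
    proof -
      have "(1 / \<sigma>) *\<^sub>R (lam - lam') = - (A *v x - b)" unfolding lam' using \<sigma> by simp
      then show ?thesis by (simp only: inner_minus_left inner_minus_right minus_minus inner_commute)
    qed
    show ?thesis using 1 2 mu0 True
      by (simp add: y' lagr_def a inner_diff_left)
  qed
qed

text \<open>Go around the rectangle with corners \<open>(x, y)\<close> and \<open>(xs, ys)\<close>:
  two sides use the subgradient, two the saddle point. Finiteness of \<open>l x y\<close> allows it
  to be cancelled.\<close>

lemma saddle_subdiff_monotone:
  assumes fin: "\<bar>l x y\<bar> \<noteq> \<infinity>" and pu: "(p, u) \<in> saddle_subdiff l (x, y)"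
    and sp: "(xs, ys) \<in> saddle_points l"
  shows "0 \<le> p \<bullet> (x - xs) + u \<bullet> (y - ys)"
proof -
  have "l x y + ereal (p \<bullet> (xs - x)) \<le> l xs y" using pu by (simp add: saddle_subdiff_def)
  also have "\<dots> \<le> l xs ys" using sp by (simp add: saddle_points_iff)
  also have "\<dots> \<le> l x ys" using sp by (simp add: saddle_points_iff)
  also have "\<dots> \<le> l x y - ereal (u \<bullet> (ys - y))" using pu by (simp add: saddle_subdiff_def)
  finally show ?thesis using fin by (cases "l x y") (auto simp: inner_diff_right)
qed

section \<open>Linear convergence\<close>

lemma norm_bound_lambda_max:
  fixes S :: "real^'n^'n"
  assumes S: "sym_pos_def S" and t: "0 \<le> t"
  shows "sqrt (t * (v \<bullet> (S *v v))) \<le> sqrt (t * lambda_max S) * norm v"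
proof -
  have "t * (v \<bullet> (S *v v)) \<le> t * (lambda_max S * (norm v)\<^sup>2)"
    using t by (intro mult_left_mono lambda_max_bound sym_pos_defD S)
  then have "sqrt (t * (v \<bullet> (S *v v))) \<le> sqrt (t * lambda_max S * (norm v)\<^sup>2)"
    by (simp add: mult_ac)
  then show ?thesis by (simp add: real_sqrt_mult)
qed

lemma norm_bound_lambda_min:
  fixes S :: "real^'n^'n"
  assumes S: "sym_pos_def S" and t: "0 \<le> t"
  shows "sqrt (t * lambda_min S) * norm v \<le> sqrt (t * (v \<bullet> (S *v v)))"
proof -
  have "t * (lambda_min S * (norm v)\<^sup>2) \<le> t * (v \<bullet> (S *v v))"
    using t by (intro mult_left_mono lambda_min_mem_bound sym_pos_defD S)
  then have "sqrt (t * lambda_min S * (norm v)\<^sup>2) \<le> sqrt (t * (v \<bullet> (S *v v)))"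
    by (simp add: mult_ac)
  then show ?thesis by (simp add: real_sqrt_mult)
qed

text \<open>Both conclusions follow from \<open>M + (1 - \<beta>) * D\<^sup>2 \<le> N\<close>, where
  \<open>M\<close> and \<open>N\<close> are the squared weighted distances of the new and the old
  point. The first also uses that the error bound makes \<open>M\<close> at most a multiple of
  \<open>D\<^sup>2\<close>. Both distances carry the same weight \<open>\<tau>\<close>; the change
  of weight is treated separately.\<close>

lemma one_step_contraction:
  fixes S :: "real^'n^'n" and x x' d :: "real^'n" and y y' :: "'y::real_inner"
    and \<kappa> \<rho> \<sigma> \<tau> :: real
  defines "q \<equiv> \<lambda>v. v \<bullet> (S *v v)"
  defines "D \<equiv> sqrt (\<tau> * q (x' - x) + (norm (y' - y))\<^sup>2)"
    and "pv \<equiv> d - (\<tau> / \<sigma>) *\<^sub>R (S *v (x' - x))" and "u \<equiv> (1 / \<sigma>) *\<^sub>R (y - y')"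
    and "T \<equiv> max 1 (\<tau> * lambda_max S)"
  defines "\<beta> \<equiv> (2 * \<kappa> * sqrt (\<tau> * lambda_max S) * (\<rho> + sqrt (\<rho> * T)) + 2 * \<sigma> * sqrt \<rho>)
      / (\<sigma> * sqrt (\<tau> * lambda_min S))"
  assumes S: "sym_pos_def S" and pos: "0 < \<tau>" "0 < \<sigma>" "0 < \<kappa>" "0 \<le> \<rho>" "0 \<le> 1 - \<beta>"
    and X: "convex X" "P \<in> X" "P' \<in> X"
    and P: "\<And>c. c \<in> X \<Longrightarrow> q (x - P) \<le> q (x - c)"
    and P': "\<And>c. c \<in> X \<Longrightarrow> q (x' - P') \<le> q (x' - c)"
    and Y: "Q \<in> Y" and Q': "\<And>c. c \<in> Y \<Longrightarrow> norm (y' - Q') \<le> norm (y' - c)"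
    and d: "(norm (\<sigma> *\<^sub>R d))\<^sup>2 \<le> \<rho> * D\<^sup>2"
    and mono: "0 \<le> pv \<bullet> (x' - P) + u \<bullet> (y' - Q)"
    and c: "cx \<in> X" "cy \<in> Y" "dist (x', y') (cx, cy) \<le> \<kappa> * norm (pv, u)"
  shows "(1 + (1 - \<beta>) * (\<sigma>\<^sup>2 / (\<kappa>\<^sup>2 * (sqrt \<rho> + sqrt T)\<^sup>2 * T)))
      * (\<tau> * q (x' - P') + (norm (y' - Q'))\<^sup>2) \<le> \<tau> * q (x - P) + (norm (y - Q))\<^sup>2"
    and "(1 - \<beta>) * D\<^sup>2 \<le> \<tau> * q (x - P) + (norm (y - Q))\<^sup>2"
proof -
  note spd = sym_pos_defD[OF S]
  have q0: "0 \<le> q v" for v unfolding q_def by (rule spd)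
  have T: "1 \<le> T" "\<tau> * lambda_max S \<le> T" unfolding T_def by auto
  have D2: "D\<^sup>2 = \<tau> * q (x' - x) + (norm (y' - y))\<^sup>2" unfolding D_def using q0 pos by simp
  have D0: "0 \<le> D" unfolding D_def using q0 pos by simp
  \<comment> \<open>\<open>R * D\<close> will bound the Euclidean distance from the new point to
    \<open>(cx, cy)\<close>.\<close>
  define R where "R = \<kappa> * (sqrt \<rho> + sqrt T) / \<sigma>"
  have R0: "0 < R" unfolding R_def using pos T by (simp add: add_nonneg_pos)
  have sd: "norm (\<sigma> *\<^sub>R d) \<le> sqrt \<rho> * D"
  proof (rule power2_le_imp_le)
    show "(norm (\<sigma> *\<^sub>R d))\<^sup>2 \<le> (sqrt \<rho> * D)\<^sup>2"
      using d pos(4) by (simp only: power_mult_distrib real_sqrt_pow2)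
  qed (use pos(4) D0 in simp)
  have "norm ((- \<tau>) *\<^sub>R (S *v (x' - x)), y - y') \<le> sqrt T * D"
  proof (rule power2_le_imp_le)
    have "(norm ((- \<tau>) *\<^sub>R (S *v (x' - x)), y - y'))\<^sup>2
      = \<tau>\<^sup>2 * (norm (S *v (x' - x)))\<^sup>2 + (norm (y' - y))\<^sup>2"
      by (simp add: norm_Pair power_mult_distrib norm_minus_commute)
    also have "\<dots> \<le> \<tau>\<^sup>2 * (lambda_max S * q (x' - x)) + (norm (y' - y))\<^sup>2"
      unfolding q_def by (intro add_right_mono mult_left_mono norm_mult_le_lambda_max S) auto
    also have "\<dots> = (\<tau> * lambda_max S) * (\<tau> * q (x' - x)) + 1 * (norm (y' - y))\<^sup>2"
      by (simp add: power2_eq_square)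
    also have "\<dots> \<le> T * (\<tau> * q (x' - x)) + T * (norm (y' - y))\<^sup>2"
      using T q0 pos by (intro add_mono mult_right_mono) auto
    also have "\<dots> = (sqrt T * D)\<^sup>2" using T by (simp add: D2 power_mult_distrib distrib_left)
    finally show "(norm ((- \<tau>) *\<^sub>R (S *v (x' - x)), y - y'))\<^sup>2 \<le> (sqrt T * D)\<^sup>2" .
  qed (use D0 T in simp)
  moreover have "\<sigma> *\<^sub>R (pv, u) = (\<sigma> *\<^sub>R d, 0) + ((- \<tau>) *\<^sub>R (S *v (x' - x)), y - y')"
    unfolding pv_def u_def using pos by (simp add: scaleR_diff_right)
  ultimately have "norm (\<sigma> *\<^sub>R (pv, u)) \<le> sqrt \<rho> * D + sqrt T * D"
    using sd norm_triangle_ineq[of "(\<sigma> *\<^sub>R d, 0)" "((- \<tau>) *\<^sub>R (S *v (x' - x)), y - y')"]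
    by (simp add: norm_Pair)
  then have "\<sigma> * norm (pv, u) \<le> (sqrt \<rho> + sqrt T) * D"
    using pos by (simp only: norm_scaleR abs_of_pos distrib_right)
  then have "\<kappa> * (\<sigma> * norm (pv, u)) \<le> \<kappa> * ((sqrt \<rho> + sqrt T) * D)"
    using pos by (intro mult_left_mono) auto
  then have "\<kappa> * norm (pv, u) \<le> R * D"
    unfolding R_def using pos by (simp add: field_simps)
  with c(3) have E: "norm (x' - cx, y' - cy) \<le> R * D" by (simp add: dist_norm)
  have Ex: "norm (x' - cx) \<le> R * D" using E norm_fst_le[of "x' - cx" "y' - cy"] by simp
  define M where "M = \<tau> * q (x' - P') + (norm (y' - Q'))\<^sup>2"
  define N where "N = \<tau> * q (x - P) + (norm (y - Q))\<^sup>2"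
  have M0: "0 \<le> M" unfolding M_def using q0 pos by simp
  have min: "M \<le> \<tau> * q (x' - c1) + (norm (y' - c2))\<^sup>2" if "c1 \<in> X" "c2 \<in> Y" for c1 c2
    unfolding M_def using P'[OF that(1)] Q'[OF that(2)] pos by (intro add_mono mult_left_mono power_mono) auto
  have "M \<le> \<tau> * q (x' - cx) + (norm (y' - cy))\<^sup>2" using c by (intro min) auto
  also have "\<dots> \<le> \<tau> * (lambda_max S * (norm (x' - cx))\<^sup>2) + (norm (y' - cy))\<^sup>2"
    unfolding q_def using pos by (intro add_right_mono mult_left_mono lambda_max_bound spd) auto
  also have "\<dots> = (\<tau> * lambda_max S) * (norm (x' - cx))\<^sup>2 + 1 * (norm (y' - cy))\<^sup>2" by simp
  also have "\<dots> \<le> T * (norm (x' - cx))\<^sup>2 + T * (norm (y' - cy))\<^sup>2"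
    using T by (intro add_mono mult_right_mono) auto
  also have "\<dots> = T * (norm (x' - cx, y' - cy))\<^sup>2" by (simp add: norm_Pair distrib_left)
  also have "\<dots> \<le> T * (R * D)\<^sup>2" using T E by (intro mult_left_mono power_mono) auto
  finally have MD: "M \<le> T * R\<^sup>2 * D\<^sup>2" by (simp add: power_mult_distrib)

  have "sqrt (\<tau> * q (x' - P')) \<le> sqrt (\<tau> * q (x' - cx))" using P'[OF c(1)] pos by simp
  also have "\<dots> \<le> sqrt (\<tau> * lambda_max S) * norm (x' - cx)"
    unfolding q_def using pos by (intro norm_bound_lambda_max S) auto
  also have "\<dots> \<le> sqrt (\<tau> * lambda_max S) * (R * D)"
    using Ex lambda_max_pos[OF S] pos by (intro mult_left_mono) auto
  finally have s1: "sqrt (\<tau> * q (x' - P')) \<le> sqrt (\<tau> * lambda_max S) * (R * D)" .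
  \<comment> \<open>Nonexpansiveness bounds the drift of the projection by the step, so
    \<open>x' - P\<close> is of order \<open>D\<close>.\<close>
  have "q (P' - P) \<le> q (x' - x)"
    unfolding q_def using P P' unfolding q_def by (intro spd_projection_nonexpansive[OF S X])
  then have "\<tau> * q (P' - P) \<le> D\<^sup>2" unfolding D2 using pos by (simp add: add_increasing2)
  then have s2: "sqrt (\<tau> * q (P' - P)) \<le> D" using D0 real_le_lsqrt by blast
  have "sqrt (\<tau> * q (x' - P)) \<le> sqrt (\<tau> * q (x' - P')) + sqrt (\<tau> * q (P' - P))"
    using psd_triangle[OF spd, of "x' - P'" "P' - P"] pos
    by (simp add: q_def real_sqrt_mult flip: distrib_left)
  with s1 s2 have "sqrt (\<tau> * q (x' - P)) \<le> (sqrt (\<tau> * lambda_max S) * R + 1) * D"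
    by (simp add: algebra_simps)
  then have "sqrt (\<tau> * lambda_min S) * norm (x' - P) \<le> (sqrt (\<tau> * lambda_max S) * R + 1) * D"
    using norm_bound_lambda_min[OF S, of \<tau> "x' - P"] pos unfolding q_def by linarith
  then have xP: "norm (x' - P) \<le> (sqrt (\<tau> * lambda_max S) * R + 1) * D / sqrt (\<tau> * lambda_min S)"
    using pos lambda_min_pos[OF S] by (simp add: pos_le_divide_eq mult.commute)

  have "2 * ((\<sigma> *\<^sub>R d) \<bullet> (x' - P)) \<le> 2 * (norm (\<sigma> *\<^sub>R d) * norm (x' - P))"
    by (intro mult_left_mono norm_cauchy_schwarz) simp
  also have "\<dots> \<le> 2 * ((sqrt \<rho> * D) * ((sqrt (\<tau> * lambda_max S) * R + 1) * D / sqrt (\<tau> * lambda_min S)))"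
    using sd xP D0 pos by (intro mult_left_mono mult_mono) auto
  \<comment> \<open>Here the formula for \<open>\<beta>\<close> arises: factoring
    \<open>sqrt \<rho>\<close> out of \<open>\<rho> + sqrt (\<rho> * T)\<close> exposes
    \<open>R\<close>.\<close>
  also have "\<dots> = \<beta> * D\<^sup>2"
  proof -
    have "\<rho> + sqrt (\<rho> * T) = sqrt \<rho> * (sqrt \<rho> + sqrt T)"
      using pos by (simp add: real_sqrt_mult distrib_left)
    then show ?thesis unfolding \<beta>_def R_def using pos lambda_min_pos[OF S]
      by (simp add: field_simps power2_eq_square)
  qed
  finally have cross: "2 * ((\<sigma> *\<^sub>R d) \<bullet> (x' - P)) \<le> \<beta> * D\<^sup>2" .

  have "0 \<le> \<sigma> * (pv \<bullet> (x' - P) + u \<bullet> (y' - Q))" using mono pos by simp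
  also have "\<dots> = (\<sigma> *\<^sub>R pv) \<bullet> (x' - P) + (\<sigma> *\<^sub>R u) \<bullet> (y' - Q)" by (simp add: distrib_left)
  also have "\<sigma> *\<^sub>R pv = \<sigma> *\<^sub>R d - \<tau> *\<^sub>R (S *v (x' - x))"
    unfolding pv_def using pos by (simp add: scaleR_diff_right)
  also have "\<sigma> *\<^sub>R u = y - y'" unfolding u_def using pos by simp
  finally have m: "0 \<le> (\<sigma> *\<^sub>R d) \<bullet> (x' - P) - \<tau> * ((x' - P) \<bullet> (S *v (x' - x))) + (y - y') \<bullet> (y' - Q)"
    by (simp only: inner_diff_left[of "\<sigma> *\<^sub>R d"] inner_commute[of "\<tau> *\<^sub>R _"] inner_scaleR_right)
  \<comment> \<open>Together with its analogue for \<open>y\<close>, this three-point identity turns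
    the mixed terms of the monotonicity inequality into differences of squares.\<close>
  have "q (x - P) = q (x' - P) - 2 * ((x' - P) \<bullet> (S *v (x' - x))) + q (x' - x)"
    unfolding q_def using quadratic_form_add[OF spd(1), of "x' - P" "-1" "x' - x"]
    by (simp add: add_diff_eq)
  then have tq: "\<tau> * q (x - P) = \<tau> * q (x' - P) - 2 * (\<tau> * ((x' - P) \<bullet> (S *v (x' - x)))) + \<tau> * q (x' - x)"
    by (simp only: right_diff_distrib distrib_left mult.left_commute)
  have "(norm (y - Q))\<^sup>2 = (norm ((y' - Q) + (y - y')))\<^sup>2" by simp
  also have "\<dots> = (norm (y' - Q))\<^sup>2 + (norm (y' - y))\<^sup>2 + 2 * ((y - y') \<bullet> (y' - Q))"
    unfolding power2_norm_eq_inner inner_add by (simp add: inner_diff inner_commute)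
  finally have "\<tau> * q (x' - P) + (norm (y' - Q))\<^sup>2 + D\<^sup>2 \<le> N + 2 * ((\<sigma> *\<^sub>R d) \<bullet> (x' - P))"
    unfolding N_def tq D2 using m by simp
  moreover have "M \<le> \<tau> * q (x' - P) + (norm (y' - Q))\<^sup>2" by (intro min X Y)
  ultimately have key: "M + (1 - \<beta>) * D\<^sup>2 \<le> N" using cross by (simp add: algebra_simps)
  show "(1 - \<beta>) * D\<^sup>2 \<le> \<tau> * q (x - P) + (norm (y - Q))\<^sup>2"
    using key M0 unfolding N_def by linarith
  \<comment> \<open>The factor multiplying \<open>1 - \<beta>\<close> is the reciprocal of the
    constant in \<open>MD\<close>.\<close>
  have "\<sigma>\<^sup>2 / (\<kappa>\<^sup>2 * (sqrt \<rho> + sqrt T)\<^sup>2 * T) = 1 / (T * R\<^sup>2)"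
    unfolding R_def by (simp add: power_mult_distrib power_divide)
  moreover have "1 / (T * R\<^sup>2) * M \<le> D\<^sup>2" using MD T R0 by (simp add: field_simps)
  ultimately have "\<sigma>\<^sup>2 / (\<kappa>\<^sup>2 * (sqrt \<rho> + sqrt T)\<^sup>2 * T) * M \<le> D\<^sup>2" by simp
  from mult_left_mono[OF this pos(5)]
  show "(1 + (1 - \<beta>) * (\<sigma>\<^sup>2 / (\<kappa>\<^sup>2 * (sqrt \<rho> + sqrt T)\<^sup>2 * T)))
      * (\<tau> * q (x' - P') + (norm (y' - Q'))\<^sup>2) \<le> \<tau> * q (x - P) + (norm (y - Q))\<^sup>2"
    using key unfolding M_def[symmetric] N_def[symmetric] by (simp add: distrib_right mult.assoc)
qed

text \<open>Replace \<open>\<tau>\<close> by \<open>tmax\<close> in the numerator of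
  \<open>\<beta>\<close> and by \<open>tmin\<close> in its denominator. The lower bound on
  \<open>\<sigma>\<close> limits the part containing \<open>\<kappa>\<close> to the fraction
  \<open>1 / c\<close> of the gap \<open>a - 2 * sqrt \<rho>\<close>, which leaves
  \<open>(c - 1) / c\<close> of it.\<close>

lemma contraction_constant_bound:
  fixes \<kappa> \<rho> \<sigma> \<tau> tmin tmax lmin lmax c :: real
  defines "a \<equiv> sqrt (tmin * lmin)" and "Tm \<equiv> max 1 (tmax * lmax)" and "T \<equiv> max 1 (\<tau> * lmax)"
  defines "\<beta> \<equiv> (2 * \<kappa> * sqrt (\<tau> * lmax) * (\<rho> + sqrt (\<rho> * T)) + 2 * \<sigma> * sqrt \<rho>) / (\<sigma> * sqrt (\<tau> * lmin))"
  assumes pos: "0 < \<kappa>" "0 \<le> \<rho>" "0 < \<sigma>" "0 < tmin" "0 < lmin" "0 < lmax" "1 < c"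
    and \<tau>: "tmin \<le> \<tau>" "\<tau> \<le> tmax" and gap: "0 < a - 2 * sqrt \<rho>"
    and \<sigma>: "c * ((2 * \<kappa> * sqrt (tmax * lmax) * (\<rho> + sqrt (\<rho> * Tm))) / (a - 2 * sqrt \<rho>)) \<le> \<sigma>"
  shows "(c - 1) / c * ((a - 2 * sqrt \<rho>) / a) \<le> 1 - \<beta>"
    and "(c - 1) / c * ((a - 2 * sqrt \<rho>) / a) * (\<sigma>\<^sup>2 / (\<kappa>\<^sup>2 * (sqrt \<rho> + sqrt Tm)\<^sup>2 * Tm))
      \<le> (1 - \<beta>) * (\<sigma>\<^sup>2 / (\<kappa>\<^sup>2 * (sqrt \<rho> + sqrt T)\<^sup>2 * T))"
proof -
  have a0: "0 < a" unfolding a_def using pos by simp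
  have T: "1 \<le> T" "T \<le> Tm"
    unfolding T_def Tm_def using mult_right_mono[OF \<tau>(2) less_imp_le[OF pos(6)]] by auto
  define K where "K = 2 * \<kappa> * sqrt (tmax * lmax) * (\<rho> + sqrt (\<rho> * Tm))"
  define L where "L = 2 * \<kappa> * sqrt (\<tau> * lmax) * (\<rho> + sqrt (\<rho> * T))"
  have L0: "0 \<le> L" unfolding L_def using \<tau> pos T by simp
  have "sqrt (\<tau> * lmax) \<le> sqrt (tmax * lmax)" "sqrt (\<rho> * T) \<le> sqrt (\<rho> * Tm)"
    using \<tau> pos T by (auto intro!: mult_mono)
  then have "L \<le> K"
    unfolding L_def K_def using \<tau> pos T by (intro mult_mono) auto
  note L = L0 this
  have Ks: "c * K \<le> \<sigma> * (a - 2 * sqrt \<rho>)"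
    using \<sigma> gap unfolding K_def[symmetric] by (simp add: pos_divide_le_eq)
  have "a \<le> sqrt (\<tau> * lmin)" unfolding a_def using \<tau> pos by (intro real_sqrt_le_mono mult_right_mono) auto
  then have "\<beta> \<le> (K + 2 * \<sigma> * sqrt \<rho>) / (\<sigma> * a)"
    unfolding \<beta>_def L_def[symmetric] using L pos a0 by (intro frac_le add_mono mult_left_mono) auto
  also have "\<dots> \<le> (\<sigma> * (a - 2 * sqrt \<rho>) / c + 2 * \<sigma> * sqrt \<rho>) / (\<sigma> * a)"
    using Ks pos a0 by (intro divide_right_mono add_right_mono) (auto simp: pos_le_divide_eq mult.commute)
  also have "\<dots> = 1 - (c - 1) / c * ((a - 2 * sqrt \<rho>) / a)"
    using pos a0 by (simp add: field_simps)
  finally show 1: "(c - 1) / c * ((a - 2 * sqrt \<rho>) / a) \<le> 1 - \<beta>" by linarith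
  have 0: "0 < (c - 1) / c * ((a - 2 * sqrt \<rho>) / a)" using pos a0 gap by simp
  have "\<kappa>\<^sup>2 * (sqrt \<rho> + sqrt T)\<^sup>2 * T \<le> \<kappa>\<^sup>2 * (sqrt \<rho> + sqrt Tm)\<^sup>2 * Tm"
    using T pos by (intro mult_mono mult_left_mono power_mono add_left_mono) auto
  moreover have "0 < \<kappa>\<^sup>2 * (sqrt \<rho> + sqrt T)\<^sup>2 * T"
  proof -
    have "0 < sqrt \<rho> + sqrt T" using T pos by (intro add_nonneg_pos) auto
    then show ?thesis using T pos by simp
  qed
  ultimately have "\<sigma>\<^sup>2 / (\<kappa>\<^sup>2 * (sqrt \<rho> + sqrt Tm)\<^sup>2 * Tm) \<le> \<sigma>\<^sup>2 / (\<kappa>\<^sup>2 * (sqrt \<rho> + sqrt T)\<^sup>2 * T)"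
    by (intro frac_le) auto
  then show "(c - 1) / c * ((a - 2 * sqrt \<rho>) / a) * (\<sigma>\<^sup>2 / (\<kappa>\<^sup>2 * (sqrt \<rho> + sqrt Tm)\<^sup>2 * Tm))
      \<le> (1 - \<beta>) * (\<sigma>\<^sup>2 / (\<kappa>\<^sup>2 * (sqrt \<rho> + sqrt T)\<^sup>2 * T))"
    using 1 0 T by (intro mult_mono) auto
qed

text \<open>Iterating the growth condition gives a partial product, and all factors are at least
  1.\<close>

lemma prodinf_upper_bound:
  fixes \<tau> \<nu> :: "nat \<Rightarrow> real"
  assumes \<tau>: "\<And>k. 0 < \<tau> k" "\<And>k. \<tau> (Suc k) \<le> (1 + \<nu> k) * \<tau> k"
    and \<nu>: "\<And>k. 0 \<le> \<nu> k" "summable \<nu>"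
  shows "\<tau> k \<le> \<tau> 0 * (\<Prod>k. 1 + \<nu> k)"
proof -
  have "\<tau> k \<le> \<tau> 0 * (\<Prod>i<k. 1 + \<nu> i)"
  proof (induction k)
    case (Suc k)
    have "\<tau> (Suc k) \<le> (1 + \<nu> k) * (\<tau> 0 * (\<Prod>i<k. 1 + \<nu> i))"
      using \<tau>(2)[of k] Suc \<nu>(1)[of k] by (meson add_nonneg_nonneg mult_left_mono order_trans zero_le_one)
    then show ?case by (simp add: mult_ac)
  qed simp
  moreover have "convergent_prod (\<lambda>k. 1 + \<nu> k)"
    using \<nu> by (intro abs_convergent_prod_imp_convergent_prod summable_imp_abs_convergent_prod) simp
  then have "(\<Prod>i<k. 1 + \<nu> i) \<le> (\<Prod>k. 1 + \<nu> k)"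
    using \<nu>(1) by (intro prod_le_prodinf convergent_prod_has_prod) (auto intro: add_nonneg_nonneg)
  ultimately show ?thesis using \<tau>(1)[of 0] by (meson less_imp_le mult_left_mono order_trans)
qed

lemma Diag_SI_wnorm:
  "wnorm (Diag_SI t S) (a, b) = sqrt (t * (a \<bullet> (S *v a)) + (norm b)\<^sup>2)"
  by (simp add: wnorm_def Diag_SI_def power2_norm_eq_inner flip: scaleR_matrix_vector_assoc)

lemma continuous_on_Diag_SI:
  "continuous_on UNIV (Diag_SI t S :: (real^'n) \<times> 'y::real_normed_vector \<Rightarrow> _)"
proof -
  have "Diag_SI t S = (\<lambda>z::(real^'n) \<times> 'y. ((t *\<^sub>R S) *v fst z, snd z))"
    by (simp add: Diag_SI_def fun_eq_iff)
  then show ?thesis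
    by (auto intro!: continuous_intros continuous_on_compose2[OF matrix_vector_mult_linear_continuous_on[of UNIV]])
qed

text \<open>The ratio test makes \<open>m\<close> summable, hence also the steps of
  \<open>x\<close>, and these telescope.\<close>

lemma convergent_of_geometric_steps:
  fixes x :: "nat \<Rightarrow> 'a::banach" and m :: "nat \<Rightarrow> real"
  assumes q: "q < 1" and m: "\<forall>\<^sub>F k in sequentially. 0 \<le> m k \<and> m (Suc k) \<le> q * m k"
    and x: "\<forall>\<^sub>F k in sequentially. norm (x (Suc k) - x k) \<le> C * m k"
  shows "convergent x"
proof -
  obtain n where n: "\<And>k. n \<le> k \<Longrightarrow> 0 \<le> m k \<and> m (Suc k) \<le> q * m k"
    using m unfolding eventually_sequentially by blast
  have "summable m"
    using q n by (intro summable_ratio_test[of q n]) (auto simp: le_Suc_eq)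
  then have "summable (\<lambda>k. C * m k)" by (rule summable_mult)
  then have "summable (\<lambda>k. x (Suc k) - x k)" by (rule summable_comparison_test_ev[OF x])
  then have "convergent (\<lambda>k. x k - x 0)"
    by (simp add: summable_iff_convergent sum_lessThan_telescope)
  from convergent_add[OF this convergent_const[of "x 0"]] show ?thesis by simp
qed

theorem theorem3p2:
  fixes f :: "real^'n \<Rightarrow> ereal" and A :: "real^'n^'m1" and b :: "real^'m1"
    and g :: "real^'n \<Rightarrow> real^'m2" and S :: "real^'n^'n"
    and \<rho> \<sigma>\<^sub>m\<^sub>i\<^sub>n \<tau>\<^sub>m\<^sub>i\<^sub>n r \<kappa> c :: real and \<sigma> \<tau> \<nu> :: "nat \<Rightarrow> real"
    and w x \<Delta> :: "nat \<Rightarrow> real^'n" and lam :: "nat \<Rightarrow> real^'m1" and mu :: "nat \<Rightarrow> real^'m2"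
  defines "l \<equiv> lagr f A b g"
    and "\<tau>\<^sub>m\<^sub>a\<^sub>x \<equiv> \<tau> 0 * (\<Prod>k. 1 + \<nu> k)"
  defines "\<tau>bar\<^sub>m\<^sub>a\<^sub>x \<equiv> max 1 (\<tau>\<^sub>m\<^sub>a\<^sub>x * lambda_max S)"
    and "\<tau>bar \<equiv> (\<lambda>k. max 1 (\<tau> k * lambda_max S))"
    and "\<Lambda> \<equiv> (\<lambda>k. Diag_SI (\<tau> k) S)"
    and "z \<equiv> (\<lambda>k. (x k, (lam k, mu k)))"
  defines "\<gamma> \<equiv> (\<lambda>k. (1 - (2 * \<kappa> * sqrt (\<tau> k * lambda_max S) * (\<rho> + sqrt (\<rho> * \<tau>bar k))
                           + 2 * \<sigma> k * sqrt \<rho>)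
                          / (\<sigma> k * sqrt (\<tau> k * lambda_min S)))
                     * ((\<sigma> k)\<^sup>2 / (\<kappa>\<^sup>2 * (sqrt \<rho> + sqrt (\<tau>bar k))\<^sup>2 * \<tau>bar k)))"
  defines "\<theta> \<equiv> (\<lambda>k. sqrt ((1 + \<nu> k) / (1 + \<gamma> k)))"
  assumes f: "proper_fun f" "lsc_fun f" "convex_fun f"
    and g: "\<And>i. C1_fun (\<lambda>x. g x $ i)" "\<And>i. convex_on UNIV (\<lambda>x. g x $ i)"
    and \<rho>: "0 \<le> \<rho>" "\<rho> < 1"
    and S: "sym_pos_def S"
    and \<sigma>: "0 < \<sigma>\<^sub>m\<^sub>i\<^sub>n" "\<And>k. \<sigma> k \<ge> \<sigma>\<^sub>m\<^sub>i\<^sub>n"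
    and \<tau>: "0 < \<tau>\<^sub>m\<^sub>i\<^sub>n" "\<And>k. \<tau> k \<ge> \<tau>\<^sub>m\<^sub>i\<^sub>n" "\<And>k. \<tau> (Suc k) \<le> (1 + \<nu> k) * \<tau> k"
    and \<nu>: "\<And>k. 0 \<le> \<nu> k" "summable \<nu>"
    and saddle: "saddle_points l \<noteq> {}"
    and eb: "\<And>r. 0 < r \<Longrightarrow> \<exists>\<kappa>>0. error_bound l r \<kappa>"
    and alg: "rip2alm f A b g \<rho> \<sigma> \<tau> S w x \<Delta> lam mu"
    and r: "0 < r" "\<And>k. edist (z k) (saddle_points l) \<le> ereal r"
    and \<kappa>: "0 < \<kappa>" "error_bound l r \<kappa>"
    and c: "1 < c"
    and gap: "sqrt (\<tau>\<^sub>m\<^sub>i\<^sub>n * lambda_min S) - 2 * sqrt \<rho> > 0"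
    and liminf_\<sigma>: "liminf (\<lambda>k. ereal (\<sigma> k)) >
      ereal (c * ((2 * \<kappa> * sqrt (\<tau>\<^sub>m\<^sub>a\<^sub>x * lambda_max S) * (\<rho> + sqrt (\<rho> * \<tau>bar\<^sub>m\<^sub>a\<^sub>x)))
                  / (sqrt (\<tau>\<^sub>m\<^sub>i\<^sub>n * lambda_min S) - 2 * sqrt \<rho>)))"
  shows "(\<forall>\<^sub>F k in sequentially.
            \<gamma> k \<ge> (c - 1) / c
                   * ((sqrt (\<tau>\<^sub>m\<^sub>i\<^sub>n * lambda_min S) - 2 * sqrt \<rho>) / sqrt (\<tau>\<^sub>m\<^sub>i\<^sub>n * lambda_min S))
                   * ((\<sigma> k)\<^sup>2 / (\<kappa>\<^sup>2 * (sqrt \<rho> + sqrt \<tau>bar\<^sub>m\<^sub>a\<^sub>x)\<^sup>2 * \<tau>bar\<^sub>m\<^sub>a\<^sub>x))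
          \<and> (c - 1) / c
                   * ((sqrt (\<tau>\<^sub>m\<^sub>i\<^sub>n * lambda_min S) - 2 * sqrt \<rho>) / sqrt (\<tau>\<^sub>m\<^sub>i\<^sub>n * lambda_min S))
                   * ((\<sigma> k)\<^sup>2 / (\<kappa>\<^sup>2 * (sqrt \<rho> + sqrt \<tau>bar\<^sub>m\<^sub>a\<^sub>x)\<^sup>2 * \<tau>bar\<^sub>m\<^sub>a\<^sub>x)) > 0
          \<and> wdist (\<Lambda> (Suc k)) (z (Suc k)) (saddle_points l)
              \<le> ereal (\<theta> k) * wdist (\<Lambda> k) (z k) (saddle_points l))
       \<and> limsup (\<lambda>k. ereal (\<theta> k)) < 1
       \<and> convergent x"
proof -

  \<comment> \<open>Positivity and bounds for the parameters\<close>
  note spd = sym_pos_defD[OF S]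
  have lmin: "0 < lambda_min S" and lmax: "0 < lambda_max S"
    using S by (rule lambda_min_pos, rule lambda_max_pos)
  have \<tau>0: "0 < \<tau> k" and \<sigma>0: "0 < \<sigma> k" for k
    using \<tau>(1) \<tau>(2)[of k] \<sigma>(1) \<sigma>(2)[of k] by linarith+
  have \<tau>max: "\<tau> k \<le> \<tau>\<^sub>m\<^sub>a\<^sub>x" for k
    unfolding \<tau>\<^sub>m\<^sub>a\<^sub>x_def using \<tau>0 \<tau>(3) \<nu> by (rule prodinf_upper_bound)

  \<comment> \<open>Product structure and convexity of the saddle set\<close>
  obtain xs ys where sp: "(xs, ys) \<in> saddle_points l" using saddle by auto
  define X where "X = {x. \<forall>y. l x y \<le> l xs ys}"
  define Y where "Y = {y. \<forall>x. l xs ys \<le> l x y}"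
  have XY: "saddle_points l = X \<times> Y"
    using saddle_points_product[OF sp] unfolding X_def Y_def .
  have ne: "closure X \<noteq> {}" "closure Y \<noteq> {}" using sp unfolding XY by auto
  have "\<bar>l xs ys\<bar> \<noteq> \<infinity>"
    unfolding l_def using f(1) sp[unfolded l_def] by (rule saddle_value_finite)
  then obtain v where v: "l xs ys = ereal v" by auto
  \<comment> \<open>Since the saddle value is a real number, \<open>X\<close> is an intersection of
    convex sublevel sets.\<close>
  have "X = (\<Inter>y. {x. l x y \<le> ereal v})" unfolding X_def v by auto
  moreover have "convex {x. l x y \<le> ereal v}" for y
    unfolding l_def using f(3) g(2) by (rule convex_lagr_sublevel)
  ultimately have convX: "convex (closure X)" by (auto intro!: convex_closure convex_INT)

  \<comment> \<open>Projections of the iterates and their weighted distances\<close>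
  define q where "q u = u \<bullet> (S *v u)" for u
  have q0: "0 \<le> q u" for u unfolding q_def by (rule spd)
  \<comment> \<open>Scaling by \<open>\<tau> k\<close> does not change the minimizer, so the
    projection in the \<open>S\<close>-form serves the weights of all indices.\<close>
  have "\<exists>p\<in>closure X. \<forall>c\<in>closure X. q (x k - p) \<le> q (x k - c)" for k
    unfolding q_def by (rule spd_projection_exists[OF S closed_closure ne(1), of "x k"]) blast
  then obtain P where P: "\<And>k. P k \<in> closure X" "\<And>k c. c \<in> closure X \<Longrightarrow> q (x k - P k) \<le> q (x k - c)"
    by metis
  define y where "y k = (lam k, mu k)" for k
  have "\<exists>p\<in>closure Y. \<forall>c\<in>closure Y. norm (y k - p) \<le> norm (y k - c)" for k
    using distance_attains_inf[OF closed_closure ne(2), of "y k"] unfolding dist_norm by metis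
  then obtain Q where Q: "\<And>k. Q k \<in> closure Y" "\<And>k c. c \<in> closure Y \<Longrightarrow> norm (y k - Q k) \<le> norm (y k - c)"
    by metis
  have zk: "z k = (x k, y k)" for k unfolding z_def y_def by simp

  define M where "M k = \<tau> k * q (x k - P k) + (norm (y k - Q k))\<^sup>2" for k
  have M0: "0 \<le> M k" for k unfolding M_def using q0 \<tau>0[of k] by simp
  have wd: "wdist (\<Lambda> k) (z k) (saddle_points l) = ereal (sqrt (M k))" for k
  proof -
    have "wdist (Diag_SI (\<tau> k) S) (z k) (X \<times> Y) = ereal (wnorm (Diag_SI (\<tau> k) S) (z k - (P k, Q k)))"
    proof (rule wdist_eq_closure_minimizer)
      show "(P k, Q k) \<in> closure (X \<times> Y)" using P(1) Q(1) by (simp add: closure_Times)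
      show "continuous_on UNIV (Diag_SI (\<tau> k) S :: (real^'n) \<times> (real^'m1) \<times> (real^'m2) \<Rightarrow> _)"
        by (rule continuous_on_Diag_SI)
      fix c assume "c \<in> X \<times> Y"
      then obtain c1 c2 where c: "c = (c1, c2)" "c1 \<in> closure X" "c2 \<in> closure Y"
        using closure_subset[of X] closure_subset[of Y] by (elim SigmaE) blast
      have "\<tau> k * q (x k - P k) + (norm (y k - Q k))\<^sup>2 \<le> \<tau> k * q (x k - c1) + (norm (y k - c2))\<^sup>2"
        using P(2)[OF c(2)] Q(2)[OF c(3)] \<tau>0[of k] by (intro add_mono mult_left_mono power_mono) auto
      then show "wnorm (Diag_SI (\<tau> k) S) (z k - (P k, Q k)) \<le> wnorm (Diag_SI (\<tau> k) S) (z k - c)"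
        by (simp add: zk c(1) Diag_SI_wnorm q_def)
    qed
    then show ?thesis by (simp add: XY \<Lambda>_def zk Diag_SI_wnorm M_def q_def)
  qed

  \<comment> \<open>Constants and their eventual bounds\<close>
  define a where "a = sqrt (\<tau>\<^sub>m\<^sub>i\<^sub>n * lambda_min S)"
  define B where "B = (c - 1) / c * ((a - 2 * sqrt \<rho>) / a)"
  define \<beta> where "\<beta> k = (2 * \<kappa> * sqrt (\<tau> k * lambda_max S) * (\<rho> + sqrt (\<rho> * \<tau>bar k))
      + 2 * \<sigma> k * sqrt \<rho>) / (\<sigma> k * sqrt (\<tau> k * lambda_min S))" for k
  define D where "D k = sqrt (\<tau> k * q (x (Suc k) - x k) + (norm (y (Suc k) - y k))\<^sup>2)" for k
  have D2: "(D k)\<^sup>2 = \<tau> k * q (x (Suc k) - x k) + (norm (y (Suc k) - y k))\<^sup>2" for k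
    unfolding D_def using q0 \<tau>0[of k] by simp
  have B0: "0 < B"
    unfolding B_def using c gap \<tau>(1) lmin by (simp add: a_def)
  have large: "\<forall>\<^sub>F k in sequentially. B \<le> 1 - \<beta> k \<and>
      B * ((\<sigma> k)\<^sup>2 / (\<kappa>\<^sup>2 * (sqrt \<rho> + sqrt \<tau>bar\<^sub>m\<^sub>a\<^sub>x)\<^sup>2 * \<tau>bar\<^sub>m\<^sub>a\<^sub>x)) \<le> \<gamma> k"
    using less_LiminfD[OF liminf_\<sigma>]
  proof eventually_elim
    case (elim k)
    then have "c * ((2 * \<kappa> * sqrt (\<tau>\<^sub>m\<^sub>a\<^sub>x * lambda_max S) * (\<rho> + sqrt (\<rho> * \<tau>bar\<^sub>m\<^sub>a\<^sub>x)))
                  / (sqrt (\<tau>\<^sub>m\<^sub>i\<^sub>n * lambda_min S) - 2 * sqrt \<rho>)) \<le> \<sigma> k" by simp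
    from contraction_constant_bound[OF \<kappa>(1) \<rho>(1) \<sigma>0 \<tau>(1) lmin lmax c \<tau>(2) \<tau>max gap
        this[unfolded \<tau>bar\<^sub>m\<^sub>a\<^sub>x_def]]
    show ?case
      unfolding B_def \<beta>_def \<gamma>_def a_def \<tau>bar_def \<tau>bar\<^sub>m\<^sub>a\<^sub>x_def by simp
  qed

  \<comment> \<open>One iteration of the algorithm\<close>
  have step: "(1 + \<gamma> k) * (\<tau> k * q (x (Suc k) - P (Suc k)) + (norm (y (Suc k) - Q (Suc k)))\<^sup>2) \<le> M k
      \<and> (1 - \<beta> k) * (D k)\<^sup>2 \<le> M k" if \<beta>1: "0 \<le> 1 - \<beta> k" for k
  proof -
    obtain v where v: "v \<in> subdiff (\<lambda>z. aug_lagr f A b g (\<sigma> k) z (lam k) (mu k)) (x (Suc k))"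
      and \<Delta>: "\<Delta> (Suc k) = v + (\<tau> k / \<sigma> k) *\<^sub>R (S *v (x (Suc k) - x k))"
      and err: "2 * \<bar>(w k - x (Suc k)) \<bullet> (\<sigma> k *\<^sub>R \<Delta> (Suc k))\<bar> + (norm (\<sigma> k *\<^sub>R \<Delta> (Suc k)))\<^sup>2
         \<le> \<rho> * ((norm (\<sigma> k *\<^sub>R (A *v x (Suc k) - b)))\<^sup>2
               + (norm (\<chi> i. min (mu k $ i) (- \<sigma> k * g (x (Suc k)) $ i)))\<^sup>2
               + \<tau> k * (wnorm ((*v) S) (x (Suc k) - x k))\<^sup>2)"
      and lam: "lam (Suc k) = lam k + \<sigma> k *\<^sub>R (A *v x (Suc k) - b)"
      and mu: "mu (Suc k) = (\<chi> i. max 0 (mu k $ i + \<sigma> k * g (x (Suc k)) $ i))"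
      using alg unfolding rip2alm_def by blast
    have fin: "\<bar>f (x (Suc k))\<bar> \<noteq> \<infinity>" using f(1) v by (rule aug_lagr_subdiff_finite)
    define u where "u = (1 / \<sigma> k) *\<^sub>R (y k - y (Suc k))"
    have v': "v = \<Delta> (Suc k) - (\<tau> k / \<sigma> k) *\<^sub>R (S *v (x (Suc k) - x k))" using \<Delta> by simp
    have incl: "(v, u) \<in> saddle_subdiff l (x (Suc k), y (Suc k))"
      using aug_lagr_subdiff_lagr[OF f(1,3) g(2) \<sigma>0 v lam mu]
        multiplier_step_subdiff[where f = f and x = "x (Suc k)" and g = g, OF fin \<sigma>0 lam mu]
      unfolding saddle_subdiff_def subdiff_def l_def y_def u_def by blast
    have "0 \<le> mu (Suc k)" unfolding mu by (simp add: less_eq_vec_def)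
    then have lfin: "\<bar>l (x (Suc k)) (y (Suc k))\<bar> \<noteq> \<infinity>"
      using fin by (auto simp: l_def lagr_def y_def)
    \<comment> \<open>Monotonicity is available at genuine saddle points and passes to the limit
      \<open>(P k, Q k)\<close> in their closure.\<close>
    have mono: "0 \<le> v \<bullet> (x (Suc k) - P k) + u \<bullet> (y (Suc k) - Q k)"
    proof -
      have "(P k, Q k) \<in> closure (saddle_points l)" using P(1) Q(1) by (simp add: XY closure_Times)
      then obtain s where s: "\<And>n. s n \<in> saddle_points l" "s \<longlonglongrightarrow> (P k, Q k)"
        unfolding closure_sequential by blast
      have "0 \<le> v \<bullet> (x (Suc k) - fst (s n)) + u \<bullet> (y (Suc k) - snd (s n))" for n
        using saddle_subdiff_monotone[OF lfin incl, of "fst (s n)" "snd (s n)"] s(1)[of n] by simp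
      moreover have "(\<lambda>n. v \<bullet> (x (Suc k) - fst (s n)) + u \<bullet> (y (Suc k) - snd (s n)))
          \<longlonglongrightarrow> v \<bullet> (x (Suc k) - fst (P k, Q k)) + u \<bullet> (y (Suc k) - snd (P k, Q k))"
        by (intro tendsto_intros s(2))
      ultimately show ?thesis using LIMSEQ_le_const by fastforce
    qed
    have "edist (0, 0) (saddle_subdiff l (z (Suc k))) \<le> ereal (dist (0, 0) (v, u))"
      unfolding edist_def zk using incl by (rule INF_lower)
    then have "edist (0, 0) (saddle_subdiff l (z (Suc k))) \<le> ereal (norm (v, u))"
      by (simp add: dist_norm norm_Pair dist_Pair_Pair)
    then have "ereal \<kappa> * edist (0, 0) (saddle_subdiff l (z (Suc k))) \<le> ereal \<kappa> * ereal (norm (v, u))"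
      using \<kappa>(1) by (intro ereal_mult_left_mono) auto
    moreover have "edist (z (Suc k)) (saddle_points l) \<le> ereal \<kappa> * edist (0, 0) (saddle_subdiff l (z (Suc k)))"
      using \<kappa>(2) r(2) unfolding error_bound_def by blast
    ultimately have "edist (z (Suc k)) (saddle_points l) \<le> ereal (\<kappa> * norm (v, u))"
      by (simp add: order_trans)
    then obtain cp where "cp \<in> closure (saddle_points l)" "dist (z (Suc k)) cp \<le> \<kappa> * norm (v, u)"
      using edist_le_imp_closure_point[OF saddle] by blast
    then obtain cx cy where c: "cx \<in> closure X" "cy \<in> closure Y"
      "dist (x (Suc k), y (Suc k)) (cx, cy) \<le> \<kappa> * norm (v, u)"
      by (cases cp) (auto simp: XY closure_Times zk)
    \<comment> \<open>By \<open>min m (- s) = m - max 0 (m + s)\<close>, the bracket in the stopping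
      criterion is the squared weighted step \<open>(D k)\<^sup>2\<close>.\<close>
    have "(\<chi> i. min (mu k $ i) (- \<sigma> k * g (x (Suc k)) $ i)) = mu k - mu (Suc k)"
      unfolding mu by (simp add: vec_eq_iff min_def max_def)
    moreover have "\<sigma> k *\<^sub>R (A *v x (Suc k) - b) = lam (Suc k) - lam k" unfolding lam by simp
    moreover have "(wnorm ((*v) S) (x (Suc k) - x k))\<^sup>2 = q (x (Suc k) - x k)"
      using q0[of "x (Suc k) - x k"] unfolding wnorm_def q_def by simp
    ultimately have "(norm (\<sigma> k *\<^sub>R \<Delta> (Suc k)))\<^sup>2 \<le> \<rho> * (D k)\<^sup>2"
      using err by (simp add: D2 y_def norm_Pair norm_minus_commute[of "mu k"] add_ac)
    note d = this[unfolded D_def q_def]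
    show ?thesis
      using one_step_contraction[OF S \<tau>0 \<sigma>0 \<kappa>(1) \<rho>(1) \<beta>1[unfolded \<beta>_def \<tau>bar_def] convX P(1) P(1)
        P(2)[unfolded q_def] P(2)[unfolded q_def] Q(1) Q(2) d mono[unfolded v' u_def] c(1,2) c(3)[unfolded v' u_def]]
      unfolding \<beta>_def \<tau>bar_def \<gamma>_def M_def D_def q_def by simp
  qed

  \<comment> \<open>A uniform linear rate\<close>
  \<comment> \<open>Replacing \<open>\<sigma> k\<close> by its lower bound gives a number,
    independent of \<open>k\<close>, that eventually lies below \<open>\<gamma> k\<close>.\<close>
  define \<delta> where "\<delta> = B * (\<sigma>\<^sub>m\<^sub>i\<^sub>n\<^sup>2 / (\<kappa>\<^sup>2 * (sqrt \<rho> + sqrt \<tau>bar\<^sub>m\<^sub>a\<^sub>x)\<^sup>2 * \<tau>bar\<^sub>m\<^sub>a\<^sub>x))"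
  have den: "0 < \<kappa>\<^sup>2 * (sqrt \<rho> + sqrt \<tau>bar\<^sub>m\<^sub>a\<^sub>x)\<^sup>2 * \<tau>bar\<^sub>m\<^sub>a\<^sub>x"
  proof -
    have T: "1 \<le> \<tau>bar\<^sub>m\<^sub>a\<^sub>x" unfolding \<tau>bar\<^sub>m\<^sub>a\<^sub>x_def by simp
    then have "0 < sqrt \<rho> + sqrt \<tau>bar\<^sub>m\<^sub>a\<^sub>x" using \<rho> by (intro add_nonneg_pos) auto
    then show ?thesis using T \<kappa>(1) by simp
  qed
  have \<delta>0: "0 < \<delta>" unfolding \<delta>_def using B0 den \<sigma>(1) by simp
  have lower: "\<delta> \<le> B * ((\<sigma> k)\<^sup>2 / (\<kappa>\<^sup>2 * (sqrt \<rho> + sqrt \<tau>bar\<^sub>m\<^sub>a\<^sub>x)\<^sup>2 * \<tau>bar\<^sub>m\<^sub>a\<^sub>x))" for k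
    unfolding \<delta>_def using B0 den \<sigma> by (intro mult_left_mono divide_right_mono power_mono) auto

  have sqrtM: "sqrt (M (Suc k)) \<le> \<theta> k * sqrt (M k)" if "B \<le> 1 - \<beta> k" "0 < \<gamma> k" for k
  proof -
    let ?N = "\<tau> k * q (x (Suc k) - P (Suc k)) + (norm (y (Suc k) - Q (Suc k)))\<^sup>2"
    have "(1 + \<gamma> k) * ?N \<le> M k" using step that B0 by simp
    then have N: "?N \<le> M k / (1 + \<gamma> k)" using that by (simp add: pos_le_divide_eq mult.commute)
    \<comment> \<open>Passing from the weight \<open>\<tau> k\<close> to
      \<open>\<tau> (Suc k)\<close> costs the factor \<open>1 + \<nu> k\<close>, which is granted to
      the \<open>y\<close> block as well.\<close>
    have "M (Suc k) \<le> (1 + \<nu> k) * \<tau> k * q (x (Suc k) - P (Suc k)) + (1 + \<nu> k) * (norm (y (Suc k) - Q (Suc k)))\<^sup>2"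
      unfolding M_def using \<tau>(3)[of k] q0 \<nu>(1)[of k]
      by (intro add_mono mult_right_mono) (auto simp: distrib_right)
    also have "\<dots> = (1 + \<nu> k) * ?N" by (simp add: distrib_left mult.assoc)
    also have "\<dots> \<le> (1 + \<nu> k) * (M k / (1 + \<gamma> k))" using N \<nu>(1)[of k] by (intro mult_left_mono) auto
    also have "\<dots> = (1 + \<nu> k) / (1 + \<gamma> k) * M k" by simp
    finally have "sqrt (M (Suc k)) \<le> sqrt ((1 + \<nu> k) / (1 + \<gamma> k) * M k)"
      by (rule real_sqrt_le_mono)
    then show ?thesis unfolding \<theta>_def by (simp only: real_sqrt_mult)
  qed

  \<comment> \<open>Because \<open>\<nu>\<close> tends to 0, eventually
    \<open>\<nu> k < \<delta> / 2\<close> while \<open>\<gamma> k \<ge> \<delta>\<close>; hence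
    \<open>\<theta> k \<le> t\<close>.\<close>
  define t where "t = sqrt ((1 + \<delta> / 2) / (1 + \<delta>))"
  have t: "t < 1" unfolding t_def using \<delta>0 by simp
  have "\<nu> \<longlonglongrightarrow> 0" using \<nu>(2) by (rule summable_LIMSEQ_zero)
  then have "\<forall>\<^sub>F k in sequentially. \<nu> k < \<delta> / 2" using \<delta>0 by (intro order_tendstoD(2)) auto
  then have \<theta>t: "\<forall>\<^sub>F k in sequentially. \<theta> k \<le> t"
    using large
  proof eventually_elim
    case (elim k)
    then have "\<delta> \<le> \<gamma> k" using lower[of k] by linarith
    then show ?case unfolding \<theta>_def t_def using elim \<delta>0 \<nu>(1)[of k]
      by (intro real_sqrt_le_mono frac_le) auto
  qed

  have "limsup (\<lambda>k. ereal (\<theta> k)) \<le> ereal t"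
    using \<theta>t by (intro Limsup_bounded) simp
  also have "\<dots> < 1" using t by simp
  finally have limsup: "limsup (\<lambda>k. ereal (\<theta> k)) < 1" .

  \<comment> \<open>Convergence of the primal iterates and conclusion\<close>
  have "convergent x"
  proof (rule convergent_of_geometric_steps[OF t])
    show "\<forall>\<^sub>F k in sequentially. 0 \<le> sqrt (M k) \<and> sqrt (M (Suc k)) \<le> t * sqrt (M k)"
      using large \<theta>t
    proof eventually_elim
      case (elim k)
      then have "sqrt (M (Suc k)) \<le> \<theta> k * sqrt (M k)"
        using lower[of k] \<delta>0 by (intro sqrtM) auto
      also have "\<dots> \<le> t * sqrt (M k)" using elim M0 by (intro mult_right_mono) auto
      finally show ?case using M0 by simp
    qed
    \<comment> \<open>The constant combines \<open>B * (D k)\<^sup>2 \<le> M k\<close> with the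
      bound of \<open>a\<close> times the step length by \<open>D k\<close>.\<close>
    show "\<forall>\<^sub>F k in sequentially. norm (x (Suc k) - x k) \<le> 1 / (a * sqrt B) * sqrt (M k)"
      using large
    proof eventually_elim
      case (elim k)
      have "B * (D k)\<^sup>2 \<le> (1 - \<beta> k) * (D k)\<^sup>2" using elim by (intro mult_right_mono) auto
      also have "\<dots> \<le> M k" using step elim B0 by simp
      finally have BD: "sqrt (B * (D k)\<^sup>2) \<le> sqrt (M k)" by (rule real_sqrt_le_mono)
      have "a * norm (x (Suc k) - x k) \<le> sqrt (\<tau> k * lambda_min S) * norm (x (Suc k) - x k)"
        unfolding a_def using \<tau>(2) lmin by (intro mult_right_mono real_sqrt_le_mono) auto
      also have "\<dots> \<le> sqrt (\<tau> k * q (x (Suc k) - x k))"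
        unfolding q_def using \<tau>0[of k] by (intro norm_bound_lambda_min S) auto
      also have "\<dots> \<le> D k" unfolding D_def by simp
      finally have "sqrt B * (a * norm (x (Suc k) - x k)) \<le> sqrt B * D k"
        using B0 by (intro mult_left_mono) auto
      also have "\<dots> \<le> sqrt (M k)"
        using BD q0 \<tau>0[of k] by (simp add: real_sqrt_mult D_def)
      finally show ?case using B0 \<tau>(1) lmin
        by (simp add: a_def field_simps)
    qed
  qed
  moreover have "\<forall>\<^sub>F k in sequentially.
      \<gamma> k \<ge> B * ((\<sigma> k)\<^sup>2 / (\<kappa>\<^sup>2 * (sqrt \<rho> + sqrt \<tau>bar\<^sub>m\<^sub>a\<^sub>x)\<^sup>2 * \<tau>bar\<^sub>m\<^sub>a\<^sub>x))
      \<and> B * ((\<sigma> k)\<^sup>2 / (\<kappa>\<^sup>2 * (sqrt \<rho> + sqrt \<tau>bar\<^sub>m\<^sub>a\<^sub>x)\<^sup>2 * \<tau>bar\<^sub>m\<^sub>a\<^sub>x)) > 0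
      \<and> wdist (\<Lambda> (Suc k)) (z (Suc k)) (saddle_points l)
          \<le> ereal (\<theta> k) * wdist (\<Lambda> k) (z k) (saddle_points l)"
    using large
  proof eventually_elim
    case (elim k)
    have pos: "B * ((\<sigma> k)\<^sup>2 / (\<kappa>\<^sup>2 * (sqrt \<rho> + sqrt \<tau>bar\<^sub>m\<^sub>a\<^sub>x)\<^sup>2 * \<tau>bar\<^sub>m\<^sub>a\<^sub>x)) > 0"
      using lower[of k] \<delta>0 by linarith
    have "sqrt (M (Suc k)) \<le> \<theta> k * sqrt (M k)" using elim pos by (intro sqrtM) auto
    then show ?case using elim pos unfolding wd by simp
  qed
  ultimately show ?thesis using limsup unfolding B_def a_def by blast
qed

end
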